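(* Let $n\ge 2$. There exists a constant $C(n)>0$, depending only on the dimension $n$, such that for every $0<\delta<1$, every $1<p<\infty$, every Borel measure $\mu$ in $\mathbb{R}^n$, every cube $Q$ in $\mathbb{R}^n$ and every $u\in C^1(Q)$, \[ \ell(Q)^{\delta}\left(\int_Q\int_Q \frac{|u(x)-u(y)|^p}{|x-y|^{n+\delta p}}\,dy\,d\mu(x)\right)^{\frac1p}\le \frac{C(n)\,p'}{(1-\delta)^{\frac1p}}\,\ell(Q)\left(\int_Q|\nabla u(x)|^p\,M^2(\chi_Q\mu)(x)\,dx\right)^{\frac1p}, \] where $p'=p/(p-1)$.
   Context: A cube $Q$ in $\mathbb{R}^n$ is a cartesian product of $n$ intervals of the same side length, denoted $\ell(Q)$. For a Borel measure $\nu$ in $\mathbb{R}^n$, the non-centered Hardy--Littlewood maximal function is \[ M\nu(x)=\sup_{Q\ni x}\frac{\nu(Q)}{|Q|},\qquad x\in\mathbb{R}^n, \] the supremum being over all cubes $Q$ in $\mathbb{R}^n$ containing $x$; for a function $f$, $Mf$ denotes $M\nu$ with $d\nu=|f|\,dx$. Here $\chi_Q\mu$ is the restriction of $\mu$ to $Q$, and $M^2(\chi_Q\mu)=M(M(\chi_Q\mu))$ is the twofold iterate. *)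

theory Defs
  imports "HOL-Analysis.Analysis"
begin

definition interval_of_length :: "real \<Rightarrow> real set \<Rightarrow> bool" where
  "interval_of_length l I \<longleftrightarrow>
     (\<exists>a. I = {a..a+l} \<or> I = {a<..<a+l} \<or> I = {a..<a+l} \<or> I = {a<..a+l})"

text \<open>
  \<open>cube l Q\<close> says that \<open>Q\<close> is a cube with side length \<open>\<ell>(Q) = l\<close>. Cubes are bounded and
  nondegenerate, since the averages \<open>\<nu>(Q) / |Q|\<close> are formed over them; the sides may be open,
  closed or half-open, independently of each other.
\<close>

definition cube :: "real \<Rightarrow> (real ^ 'n) set \<Rightarrow> bool" where
  "cube l Q \<longleftrightarrow> l > 0 \<and> (\<exists>I. (\<forall>i. interval_of_length l (I i)) \<and> Q = {x. \<forall>i. x $ i \<in> I i})"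

definition maximal :: "(real ^ 'n) measure \<Rightarrow> real ^ 'n \<Rightarrow> ennreal" where
  "maximal \<nu> x = (SUP Q \<in> {Q. (\<exists>l. cube l Q) \<and> x \<in> Q}. emeasure \<nu> Q / emeasure lborel Q)"

text \<open>Nonnegative functions suffice here, so no absolute value is needed in \<open>d\<nu> = |f| dx\<close>.\<close>

definition maximal_fun :: "(real ^ 'n \<Rightarrow> ennreal) \<Rightarrow> real ^ 'n \<Rightarrow> ennreal" where
  "maximal_fun f = maximal (density lborel f)"

definition restrict_to :: "(real ^ 'n) set \<Rightarrow> (real ^ 'n) measure \<Rightarrow> (real ^ 'n) measure" where
  "restrict_to Q \<mu> = density \<mu> (indicator Q)"

text \<open>
  The gradient is taken relative to \<open>Q\<close>, i.e. one-sided at points of the boundary that lie in \<open>Q\<close>.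
  On a cube, the derivative within \<open>Q\<close> is unique, so this is well-defined wherever \<open>u\<close> is
  differentiable, and it is the usual gradient in the interior.
\<close>

definition gradient_on :: "(real ^ 'n) set \<Rightarrow> (real ^ 'n \<Rightarrow> real) \<Rightarrow> real ^ 'n \<Rightarrow> real ^ 'n" where
  "gradient_on Q u x = (\<chi> i. frechet_derivative u (at x within Q) (axis i 1))"

definition C1_on :: "(real ^ 'n) set \<Rightarrow> (real ^ 'n \<Rightarrow> real) \<Rightarrow> bool" where
  "C1_on Q u \<longleftrightarrow> u differentiable_on Q \<and> continuous_on Q (gradient_on Q u)"

text \<open>Powers of extended nonnegative reals; only meant for exponents \<open>a > 0\<close>.\<close>

definition epowr :: "ennreal \<Rightarrow> real \<Rightarrow> ennreal" where
  "epowr x a = (if x = \<infinity> then \<infinity> else ennreal (enn2real x powr a))"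

end

theory Submission
  imports Defs
begin

text \<open>
  Let \<open>g\<close> be the maximal function of \<open>f = \<chi>\<^sub>Q \<bar>\<nabla>u\<bar>\<close>. Averaging \<open>u(x) - u(z)\<close> and \<open>u(y) - u(z)\<close> over \<open>z\<close> in a
  subcube of \<open>Q\<close> that contains \<open>x\<close> and \<open>y\<close> and has side at most \<open>2 \<bar>x - y\<bar>\<close> gives
  \<open>\<bar>u(x) - u(y)\<bar> \<le> 2 n \<bar>x - y\<bar> (g(x) + g(y))\<close>. Let \<open>\<nu> = \<chi>\<^sub>Q \<mu>\<close>. A dyadic decomposition shows that
  \<open>\<integral>\<^sub>Q \<bar>x - y\<bar>\<^bsup>p(1-\<delta>)-n\<^esup> dx\<close> is at most a constant times \<open>\<ell>(Q)\<^bsup>p(1-\<delta>)\<^esup> / (1 - \<delta>)\<close>, and that the same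
  integral against \<open>\<nu>\<close> is at most this bound times \<open>M\<nu>(y)\<close>. Hence the double integral is controlled by
  \<open>\<integral> g\<^sup>p d\<nu>\<close> and \<open>\<integral> g\<^sup>p M\<nu> dy\<close>. The Fefferman--Stein inequality, applied to the measures \<open>\<nu>\<close>
  and \<open>M\<nu> dy\<close>, bounds both by \<open>\<integral> f\<^sup>p M\<^sup>2\<nu>\<close>.
\<close>

section \<open>Cubes and the maximal function\<close>

text \<open>The iterate M(M\<nu>) comes from the term with g(y): the kernel integral in x leaves the
  weight M\<nu>(y), and the Fefferman--Stein inequality costs one more maximal function. The term
  with g(x) costs only M\<nu>, which is dominated by M(M\<nu>). Two features of \<mu> shape the
  argument. It may be singular, so the bound on u(x) - u(y) must hold at every pair of points of Q,
  without an exceptional null set. It need not be sigma-finite, so the order of integration can be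
  exchanged only if \<mu>(Q) is finite; otherwise M\<nu> is infinite everywhere, and the right side
  is infinite unless the gradient vanishes almost everywhere on Q, in which case u is constant
  there. The constant may depend on n only. Before the p-th root is taken, every numerical factor
  must therefore be a p-th power of such a constant; p' enters to the first power and is absorbed
  because p' \<ge> 1, and 1/(1 - \<delta>) alone keeps its first power.\<close>

definition ocube :: "real ^ 'n \<Rightarrow> real \<Rightarrow> (real ^ 'n) set" where
  "ocube c r = {x. \<forall>i. \<bar>x $ i - c $ i\<bar> < r}"

lemma interval_of_lengthE:
  assumes "interval_of_length l I"
  obtains a where "{a<..<a+l} \<subseteq> I" "I \<subseteq> {a..a+l}" "I \<in> sets borel" "convex I"
proof -
  obtain a where "I = {a..a+l} \<or> I = {a<..<a+l} \<or> I = {a..<a+l} \<or> I = {a<..a+l}"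
    using assms by (auto simp: interval_of_length_def)
  then show ?thesis
    by (intro that[of a]) (elim disjE; force)+
qed

lemma cubeE:
  fixes Q :: "(real ^ 'n::finite) set"
  assumes "cube l Q"
  obtains a where "box a (a + (\<chi> i. l)) \<subseteq> Q" "Q \<subseteq> cbox a (a + (\<chi> i. l))"
    "l > 0" "Q \<in> sets borel" "convex Q"
proof -
  obtain I where l: "l > 0" and I: "\<And>i. interval_of_length l (I i)" and Q: "Q = {x. \<forall>i. x $ i \<in> I i}"
    using assms by (auto simp: cube_def)
  have "\<forall>i. \<exists>a. {a<..<a+l} \<subseteq> I i \<and> I i \<subseteq> {a..a+l} \<and> I i \<in> sets borel \<and> convex (I i)"
    using I interval_of_lengthE by metis
  then obtain a where a: "\<And>i. {a i<..<a i+l} \<subseteq> I i" "\<And>i. I i \<subseteq> {a i..a i+l}"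
    "\<And>i. I i \<in> sets borel" "\<And>i. convex (I i)"
    by metis
  have Q': "Q = (\<Inter>i\<in>UNIV. (\<lambda>x. x $ i) -` I i)"
    by (auto simp: Q)
  show ?thesis
  proof (rule that[of "\<chi> i. a i"])
    show "box (\<chi> i. a i) ((\<chi> i. a i) + (\<chi> i. l)) \<subseteq> Q"
      using a(1) by (fastforce simp: Q mem_box_cart)
    show "Q \<subseteq> cbox (\<chi> i. a i) ((\<chi> i. a i) + (\<chi> i. l))"
      using a(2) by (fastforce simp: Q mem_box_cart)
    show "Q \<in> sets borel"
    proof -
      have "(\<lambda>x::real^'n. x $ i) -` I i \<in> sets borel" for i
        using measurable_sets[OF borel_measurable_nth[of i] a(3)[of i]] by simp
      then show ?thesis unfolding Q' by (intro sets.finite_INT) auto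
    qed
    show "convex Q"
      unfolding convex_def
    proof (intro ballI allI impI)
      fix x y :: "real^'n" and s t :: real
      assume "x \<in> Q" "y \<in> Q" "0 \<le> s" "0 \<le> t" "s + t = 1"
      then show "s *\<^sub>R x + t *\<^sub>R y \<in> Q"
        using a(4) by (simp add: Q convex_def)
    qed
  qed (use l in auto)
qed

lemma emeasure_lborel_cube:
  fixes Q :: "(real ^ 'n::finite) set"
  assumes "cube l Q"
  shows "emeasure lborel Q = ennreal (l ^ CARD('n))"
proof -
  obtain a :: "real^'n" where a: "box a (a + (\<chi> i. l)) \<subseteq> Q" "Q \<subseteq> cbox a (a + (\<chi> i. l))"
    "l > 0" "Q \<in> sets borel"
    using cubeE[OF assms] by metis
  have prod: "(\<Prod>b\<in>Basis. ((a + (\<chi> i. l)) - a) \<bullet> b) = l ^ CARD('n)"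
  proof -
    have "(\<Prod>b\<in>Basis. ((a + (\<chi> i. l)) - a) \<bullet> b) = (\<Prod>b\<in>(Basis::(real^'n) set). l)"
      by (rule prod.cong) (auto simp: Basis_vec_def inner_axis)
    then show ?thesis by simp
  qed
  have le: "a \<bullet> b \<le> (a + (\<chi> i. l)) \<bullet> b" if "b \<in> Basis" for b
    using that a(3) by (auto simp: Basis_vec_def inner_axis)
  have 1: "emeasure lborel (box a (a + (\<chi> i. l))) = ennreal (l ^ CARD('n))"
    using emeasure_lborel_box[OF le] prod by simp
  have 2: "emeasure lborel (cbox a (a + (\<chi> i. l))) = ennreal (l ^ CARD('n))"
    using emeasure_lborel_cbox[OF le] prod by simp
  show ?thesis
    using emeasure_mono[OF a(1), of lborel] emeasure_mono[OF a(2), of lborel] a(4)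
    unfolding 1 2 by simp
qed

lemma cube_ocube:
  assumes "r > 0"
  shows "cube (2 * r) (ocube c r)"
  unfolding cube_def interval_of_length_def ocube_def
proof (intro conjI exI[of _ "\<lambda>i. {c$i - r<..<c$i - r + 2*r}"] allI)
  show "2 * r > 0" using assms by simp
qed (auto simp: abs_less_iff, (smt (verit))+)

lemma open_ocube: "open (ocube c r :: (real ^ 'n::finite) set)"
proof -
  have "ocube c r = (\<Inter>i\<in>UNIV. (\<lambda>x. \<bar>x $ i - c $ i\<bar>) -` {..<r})"
    by (auto simp: ocube_def)
  also have "open \<dots>"
    by (intro open_INT ballI open_vimage continuous_intros) auto
  finally show ?thesis .
qed

lemma cube_sets_borel:
  "cube l (Q :: (real ^ 'n::finite) set) \<Longrightarrow> Q \<in> sets borel"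
  by (meson cubeE)

lemma cube_diff_le:
  fixes Q :: "(real ^ 'n::finite) set"
  assumes "cube l Q" "x \<in> Q" "y \<in> Q"
  shows "\<bar>x $ i - y $ i\<bar> \<le> l"
proof -
  obtain a where a: "Q \<subseteq> cbox a (a + (\<chi> i. l))" using cubeE[OF assms(1)] by metis
  have "a $ i \<le> x $ i \<and> x $ i \<le> a $ i + l" "a $ i \<le> y $ i \<and> y $ i \<le> a $ i + l"
    using a assms(2,3) by (auto simp: mem_box_cart subset_iff)
  then show ?thesis by linarith
qed

section \<open>Averages over cubes and superlevel sets of the maximal function\<close>

lemma emeasure_le_maximal:
  fixes Q :: "(real ^ 'n::finite) set"
  assumes "cube l Q" "x \<in> Q"
  shows "emeasure \<nu> Q \<le> maximal \<nu> x * ennreal (l ^ CARD('n))"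
proof -
  have l: "l > 0" using assms(1) by (simp add: cube_def)
  have "emeasure \<nu> Q / emeasure lborel Q \<le> maximal \<nu> x"
    unfolding maximal_def using assms by (intro SUP_upper) auto
  then have "emeasure \<nu> Q / ennreal (l ^ CARD('n)) * ennreal (l ^ CARD('n)) \<le> maximal \<nu> x * ennreal (l ^ CARD('n))"
    unfolding emeasure_lborel_cube[OF assms(1)] by (rule mult_right_mono) simp
  also have "emeasure \<nu> Q / ennreal (l ^ CARD('n)) * ennreal (l ^ CARD('n)) = emeasure \<nu> Q"
    using l by (simp add: ennreal_divide_times ennreal_mult_divide_eq)
  finally show ?thesis .
qed

text \<open>Strictness leaves room to replace a cube by a slightly larger open one. Hence the open
  cubes \<open>ocube c r\<close>, of side \<open>2 * r\<close>, decide every strict lower bound for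
  the maximal function, which makes its superlevel sets open.\<close>

lemma less_maximalE:
  fixes x :: "real ^ 'n::finite"
  assumes "ennreal t < maximal \<nu> x" "t \<ge> 0" "sets \<nu> = sets borel"
  obtains c r where "r > 0" "x \<in> ocube c r" "ennreal (t * (2 * r) ^ CARD('n)) < emeasure \<nu> (ocube c r)"
proof -
  obtain Q l where Q: "cube l Q" "x \<in> Q" "ennreal t < emeasure \<nu> Q / emeasure lborel Q"
    using assms(1) unfolding maximal_def less_SUP_iff by auto
  obtain a :: "real^'n" where a: "Q \<subseteq> cbox a (a + (\<chi> i. l))" "l > 0"
    using cubeE[OF Q(1)] by metis
  have ln: "l ^ CARD('n) > 0" using a(2) by simp
  have "ennreal (t * l ^ CARD('n)) < emeasure \<nu> Q"
  proof (rule ccontr)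
    assume "\<not> ennreal (t * l ^ CARD('n)) < emeasure \<nu> Q"
    then have "emeasure \<nu> Q / ennreal (l ^ CARD('n)) \<le> ennreal (t * l ^ CARD('n)) / ennreal (l ^ CARD('n))"
      by (intro divide_right_mono_ennreal) auto
    also have "\<dots> = ennreal t"
      using ln assms(2) a(2) by (simp add: divide_ennreal)
    finally show False using Q(3) by (simp add: emeasure_lborel_cube[OF Q(1)])
  qed
  \<comment> \<open>A finite value strictly in between: the mass of \<open>Q\<close> may be
    infinite, and the margin survives a small increase of the side from \<open>l\<close> to
    \<open>s\<close>.\<close>
  then obtain v where v: "ennreal (t * l ^ CARD('n)) < v" "v < emeasure \<nu> Q"
    using dense by blast
  then have vf: "v \<noteq> \<infinity>" by auto
  then obtain w where w: "v = ennreal w" "w \<ge> 0" by (metis ennreal_cases infinity_ennreal_def)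
  have wl: "t * l ^ CARD('n) < w"
    using v(1) w assms(2) a(2) by (simp add: ennreal_less_iff)
  have "((\<lambda>s. t * s ^ CARD('n)) \<longlongrightarrow> t * l ^ CARD('n)) (at_right l)"
    by (intro tendsto_intros)
  then have "eventually (\<lambda>s. t * s ^ CARD('n) < w) (at_right l)"
    using wl by (rule order_tendstoD)
  then have "eventually (\<lambda>s. t * s ^ CARD('n) < w \<and> s > l) (at_right l)"
    by (intro eventually_conj eventually_at_right_less)
  then obtain s where s: "t * s ^ CARD('n) < w" "s > l"
    using eventually_happens trivial_limit_at_right_real by blast
  define c where "c = a + (\<chi> i. l / 2)"
  have sub: "Q \<subseteq> ocube c (s / 2)"
  proof
    fix y assume "y \<in> Q"
    then have "y \<in> cbox a (a + (\<chi> i. l))" using a(1) by auto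
    then have "a $ i \<le> y $ i \<and> y $ i \<le> a $ i + l" for i by (simp add: mem_box_cart)
    then show "y \<in> ocube c (s / 2)"
      unfolding ocube_def c_def using s(2) by (auto simp: abs_less_iff) (smt (verit) field_sum_of_halves)+
  qed
  show ?thesis
  proof (rule that[of "s / 2" c])
    show "s / 2 > 0" using s a by simp
    show "x \<in> ocube c (s / 2)" using sub Q by auto
    have "ennreal (t * (2 * (s/2)) ^ CARD('n)) < v"
      using s a assms(2) by (simp add: w ennreal_less_iff)
    also have "v \<le> emeasure \<nu> Q" using v by simp
    also have "\<dots> \<le> emeasure \<nu> (ocube c (s / 2))"
      by (intro emeasure_mono sub) (simp add: assms(3) open_ocube)
    finally show "ennreal (t * (2 * (s/2)) ^ CARD('n)) < emeasure \<nu> (ocube c (s / 2))" .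
  qed
qed

lemma ennreal_less_maximalI:
  fixes x :: "real ^ 'n::finite"
  assumes "r > 0" "x \<in> ocube c r" "ennreal (t * (2 * r) ^ CARD('n)) < emeasure \<nu> (ocube c r)" "t \<ge> 0"
  shows "ennreal t < maximal \<nu> x"
proof (rule ccontr)
  assume "\<not> ennreal t < maximal \<nu> x"
  then have "maximal \<nu> x * ennreal ((2 * r) ^ CARD('n)) \<le> ennreal t * ennreal ((2 * r) ^ CARD('n))"
    by (intro mult_right_mono) auto
  also have "\<dots> = ennreal (t * (2 * r) ^ CARD('n))"
    using assms by (simp add: ennreal_mult)
  finally show False
    using emeasure_le_maximal[OF cube_ocube[OF assms(1)] assms(2), of \<nu>] assms(3) by simp
qed

lemma superlevel_maximal:
  fixes \<nu> :: "(real ^ 'n::finite) measure"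
  assumes "t \<ge> 0" "sets \<nu> = sets borel"
  shows "{x. ennreal t < maximal \<nu> x} =
    (\<Union>(c, r)\<in>{(c, r). r > 0 \<and> ennreal (t * (2 * r) ^ CARD('n)) < emeasure \<nu> (ocube c r)}. ocube c r)"
  using assms by (auto elim!: less_maximalE intro: ennreal_less_maximalI)

lemma open_superlevel_maximal:
  fixes \<nu> :: "(real ^ 'n::finite) measure"
  assumes "sets \<nu> = sets borel"
  shows "open {x. t < maximal \<nu> x}"
proof (cases t)
  case (real s)
  then show ?thesis by (auto simp: superlevel_maximal assms intro!: open_UN open_ocube)
qed auto

lemma borel_measurable_maximal:
  fixes \<nu> :: "(real ^ 'n::finite) measure"
  assumes "sets \<nu> = sets borel"
  shows "maximal \<nu> \<in> borel_measurable borel"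
  by (rule borel_measurableI_greater) (simp add: open_superlevel_maximal[OF assms] borel_open)

text \<open>A maximal function is lower semicontinuous, hence dominated by its own averages.\<close>

lemma maximal_le_maximal_fun_maximal:
  fixes \<nu> :: "(real ^ 'n::finite) measure"
  assumes "sets \<nu> = sets borel"
  shows "maximal \<nu> x \<le> maximal_fun (maximal \<nu>) x"
proof (rule dense_le)
  fix s assume s: "s < maximal \<nu> x"
  then obtain t where t: "s = ennreal t" "t \<ge> 0"
    by (cases s) auto
  obtain c r where cr: "r > 0" "x \<in> ocube c r" "ennreal (t * (2 * r) ^ CARD('n)) < emeasure \<nu> (ocube c r)"
    using less_maximalE[of t \<nu> x] s t assms by metis
  have big: "s \<le> maximal \<nu> y" if "y \<in> ocube c r" for y
    using ennreal_less_maximalI[OF cr(1) that cr(3) t(2)] t by auto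
  have [measurable]: "ocube c r \<in> sets borel" "maximal \<nu> \<in> borel_measurable borel"
    by (simp_all add: open_ocube borel_measurable_maximal assms)
  have "s * emeasure lborel (ocube c r) = (\<integral>\<^sup>+y. s * indicator (ocube c r) y \<partial>lborel)"
    by (simp add: nn_integral_cmult_indicator)
  also have "\<dots> \<le> (\<integral>\<^sup>+y. maximal \<nu> y * indicator (ocube c r) y \<partial>lborel)"
    by (intro nn_integral_mono) (auto simp: indicator_def big)
  also have "\<dots> = emeasure (density lborel (maximal \<nu>)) (ocube c r)"
    by (subst emeasure_density) auto
  also have "\<dots> \<le> maximal_fun (maximal \<nu>) x * ennreal ((2 * r) ^ CARD('n))"
    unfolding maximal_fun_def by (rule emeasure_le_maximal[OF cube_ocube[OF cr(1)] cr(2)])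
  finally have "ennreal ((2 * r) ^ CARD('n)) * s \<le> ennreal ((2 * r) ^ CARD('n)) * maximal_fun (maximal \<nu>) x"
    by (simp add: emeasure_lborel_cube[OF cube_ocube[OF cr(1)]] mult.commute)
  then show "s \<le> maximal_fun (maximal \<nu>) x"
    using cr(1) by (subst (asm) ennreal_mult_le_mult_iff) auto
qed

section \<open>The weak type inequality\<close>

text \<open>Greedy choice: keep a cube of largest radius, drop every cube that meets it, since such
  a cube lies in the tripled one, and recurse on the rest. Indexing by centre and radius allows the
  tripled cube to be named.\<close>

lemma finite_ocube_Vitali:
  fixes S :: "((real ^ 'n::finite) \<times> real) set"
  assumes "finite S"
  shows "\<exists>T\<subseteq>S. disjoint_family_on (\<lambda>(c, r). ocube c r) T \<and>
    (\<Union>(c, r)\<in>S. ocube c r) \<subseteq> (\<Union>(c, r)\<in>T. ocube c (3 * r))"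
  using assms
proof (induction "card S" arbitrary: S rule: less_induct)
  case less
  show ?case
  proof (cases "S = {}")
    case False
    obtain m where m: "m \<in> S" "\<And>q. q \<in> S \<Longrightarrow> snd q \<le> snd m"
      using Max_in[of "snd ` S"] Max_ge[of "snd ` S"] less.prems False
      by (metis (no_types, lifting) finite_imageI image_iff image_is_empty)
    define c r where "c = fst m" and "r = snd m"
    have cr: "m = (c, r)" by (simp add: c_def r_def)
    \<comment> \<open>The condition \<open>q \<noteq> m\<close> matters for nonpositive radii: the
      cube of \<open>m\<close> is then empty, hence disjoint from itself, and the induction would
      not descend.\<close>
    define S' where "S' = {q\<in>S. case q of (d, s) \<Rightarrow> ocube d s \<inter> ocube c r = {} \<and> q \<noteq> m}"
    have "card S' < card S"
      using m(1) less.prems by (intro psubset_card_mono) (auto simp: S'_def)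
    moreover have "finite S'" using less.prems by (auto simp: S'_def)
    ultimately obtain T where T: "T \<subseteq> S'" "disjoint_family_on (\<lambda>(c, r). ocube c r) T"
      "(\<Union>(c, r)\<in>S'. ocube c r) \<subseteq> (\<Union>(c, r)\<in>T. ocube c (3 * r))"
      using less.hyps by blast
    have triple: "ocube d s \<subseteq> ocube c (3 * r)" if ds: "(d, s) \<in> S" and meets: "ocube d s \<inter> ocube c r \<noteq> {}" for d s
    proof
      fix x assume x: "x \<in> ocube d s"
      obtain z where z: "z \<in> ocube d s" "z \<in> ocube c r" using meets by blast
      have "s \<le> r" using m(2)[OF ds] by (simp add: r_def)
      show "x \<in> ocube c (3 * r)"
        unfolding ocube_def
      proof (safe)
        fix i
        have "\<bar>x $ i - d $ i\<bar> < s" "\<bar>z $ i - d $ i\<bar> < s" "\<bar>z $ i - c $ i\<bar> < r"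
          using x z by (auto simp: ocube_def)
        then show "\<bar>x $ i - c $ i\<bar> < 3 * r" using \<open>s \<le> r\<close> by linarith
      qed
    qed
    have sub: "ocube c r \<subseteq> ocube c (3 * r)"
    proof (unfold ocube_def, safe)
      fix x i assume "\<forall>i. \<bar>x $ i - c $ i\<bar> < r"
      then have "\<bar>x $ i - c $ i\<bar> < r" by blast
      then show "\<bar>x $ i - c $ i\<bar> < 3 * r" by linarith
    qed
    show ?thesis
    proof (intro exI[of _ "insert m T"] conjI)
      show "insert m T \<subseteq> S" using m T(1) by (auto simp: S'_def)
      show "disjoint_family_on (\<lambda>(c, r). ocube c r) (insert m T)"
        using T(1,2) unfolding disjoint_family_on_def S'_def cr by (auto 4 4)
      show "(\<Union>(c, r)\<in>S. ocube c r) \<subseteq> (\<Union>(c, r)\<in>insert m T. ocube c (3 * r))"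
      proof safe
        fix d s x assume ds: "(d, s) \<in> S" "x \<in> ocube d s"
        show "x \<in> (\<Union>(c, r)\<in>insert m T. ocube c (3 * r))"
        proof (cases "(d, s) \<in> S'")
          case True
          then show ?thesis using T(3) ds by auto
        next
          case False
          then have "x \<in> ocube c (3 * r)" using ds triple sub by (auto simp: S'_def cr)
          then show ?thesis by (auto simp: cr)
        qed
      qed
    qed
  qed (auto simp: disjoint_family_on_def)
qed

text \<open>Every point z of the small cube lies in the tripled cube, whose \<nu>-mass is therefore
  at most M\<nu>(z) times its volume. Averaging this against \<open>h\<close> over the small cube
  brings M\<nu> under the integral without any doubling property of \<nu>;
  \<open>3 ^ CARD('n)\<close> is the ratio of the volumes.\<close>

lemma emeasure_ocube_weak:
  fixes \<nu> :: "(real ^ 'n::finite) measure" and h :: "real ^ 'n \<Rightarrow> ennreal"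
  assumes \<nu>: "sets \<nu> = sets borel" and h [measurable]: "h \<in> borel_measurable borel" and "r > 0" "t > 0"
    and le: "ennreal (t * (2 * r) ^ CARD('n)) \<le> emeasure (density lborel h) (ocube c r)"
  shows "ennreal t * emeasure \<nu> (ocube c (3 * r)) \<le>
    3 ^ CARD('n) * (\<integral>\<^sup>+z. h z * maximal \<nu> z * indicator (ocube c r) z \<partial>lborel)"
proof -
  let ?n = "CARD('n)"
  have [measurable]: "ocube c r \<in> sets borel" "maximal \<nu> \<in> borel_measurable borel"
    by (simp_all add: open_ocube borel_measurable_maximal \<nu>)
  have pt: "emeasure \<nu> (ocube c (3 * r)) \<le> maximal \<nu> z * ennreal ((6 * r) ^ ?n)" if "z \<in> ocube c r" for z
  proof -
    have "z \<in> ocube c (3 * r)"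
      using that \<open>r > 0\<close> by (force simp: ocube_def intro: order.strict_trans2)
    then show ?thesis
      using emeasure_le_maximal[OF cube_ocube[of "3 * r" c], of z \<nu>] \<open>r > 0\<close> by simp
  qed
  have "ennreal ((2 * r) ^ ?n) * (ennreal t * emeasure \<nu> (ocube c (3 * r))) =
      ennreal (t * (2 * r) ^ ?n) * emeasure \<nu> (ocube c (3 * r))"
    using \<open>r > 0\<close> \<open>t > 0\<close> by (simp add: ennreal_mult mult_ac)
  also have "\<dots> \<le> emeasure (density lborel h) (ocube c r) * emeasure \<nu> (ocube c (3 * r))"
    by (rule mult_right_mono[OF le]) simp
  also have "\<dots> = (\<integral>\<^sup>+z. (h z * indicator (ocube c r) z) * emeasure \<nu> (ocube c (3 * r)) \<partial>lborel)"
    by (simp add: emeasure_density nn_integral_multc)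
  also have "\<dots> \<le> (\<integral>\<^sup>+z. ennreal ((6 * r) ^ ?n) * (h z * maximal \<nu> z * indicator (ocube c r) z) \<partial>lborel)"
  proof (intro nn_integral_mono)
    fix z
    show "(h z * indicator (ocube c r) z) * emeasure \<nu> (ocube c (3 * r)) \<le>
        ennreal ((6 * r) ^ ?n) * (h z * maximal \<nu> z * indicator (ocube c r) z)"
      using mult_left_mono[OF pt, of z "h z"] by (auto simp: indicator_def mult_ac)
  qed
  also have "\<dots> = ennreal ((6 * r) ^ ?n) * (\<integral>\<^sup>+z. h z * maximal \<nu> z * indicator (ocube c r) z \<partial>lborel)"
    by (rule nn_integral_cmult) simp
  also have "ennreal ((6 * r) ^ ?n) = ennreal ((2 * r) ^ ?n) * 3 ^ ?n"
  proof -
    have "(6 * r) ^ ?n = (2 * r) ^ ?n * 3 ^ ?n" by (subst power_mult_distrib[symmetric]) simp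
    moreover have "(3::ennreal) ^ ?n = ennreal (3 ^ ?n)"
      by (simp add: ennreal_power flip: ennreal_numeral)
    ultimately show ?thesis using \<open>r > 0\<close> by (simp add: ennreal_mult mult_ac)
  qed
  finally have "ennreal ((2 * r) ^ ?n) * (ennreal t * emeasure \<nu> (ocube c (3 * r))) \<le>
      ennreal ((2 * r) ^ ?n) * (3 ^ ?n * (\<integral>\<^sup>+z. h z * maximal \<nu> z * indicator (ocube c r) z \<partial>lborel))"
    by (simp add: mult.assoc)
  then show ?thesis
    using \<open>r > 0\<close> by (subst (asm) ennreal_mult_le_mult_iff) auto
qed

text \<open>Disjointness lets the local integrals be added, since the indicators of the selected
  cubes sum to at most one. The bound does not depend on the number of cubes, which permits the
  passage to infinite families.\<close>

lemma weak_type_finite: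
  fixes \<nu> :: "(real ^ 'n::finite) measure" and h :: "real ^ 'n \<Rightarrow> ennreal"
  assumes \<nu>: "sets \<nu> = sets borel" and h [measurable]: "h \<in> borel_measurable borel" and "t > 0" "finite S"
    and S: "\<And>c r. (c, r) \<in> S \<Longrightarrow> r > 0 \<and> ennreal (t * (2 * r) ^ CARD('n)) \<le> emeasure (density lborel h) (ocube c r)"
  shows "ennreal t * emeasure \<nu> (\<Union>(c, r)\<in>S. ocube c r) \<le>
    3 ^ CARD('n) * (\<integral>\<^sup>+z. h z * maximal \<nu> z \<partial>lborel)"
proof -
  obtain T where T: "T \<subseteq> S" "disjoint_family_on (\<lambda>(c, r). ocube c r) T"
    "(\<Union>(c, r)\<in>S. ocube c r) \<subseteq> (\<Union>(c, r)\<in>T. ocube c (3 * r))"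
    using finite_ocube_Vitali[OF \<open>finite S\<close>] by blast
  have fT: "finite T" using T(1) \<open>finite S\<close> finite_subset by blast
  have oc [measurable]: "ocube c r \<in> sets borel" for c :: "real^'n" and r
    by (simp add: open_ocube)
  have [measurable]: "maximal \<nu> \<in> borel_measurable borel"
    by (simp add: borel_measurable_maximal \<nu>)
  have "emeasure \<nu> (\<Union>(c, r)\<in>S. ocube c r) \<le> emeasure \<nu> (\<Union>(c, r)\<in>T. ocube c (3 * r))"
    using fT by (intro emeasure_mono T(3)) (auto simp: \<nu>)
  also have "\<dots> \<le> (\<Sum>q\<in>T. emeasure \<nu> (case q of (c, r) \<Rightarrow> ocube c (3 * r)))"
    using fT by (intro emeasure_subadditive_finite) (auto simp: \<nu>)
  finally have "ennreal t * emeasure \<nu> (\<Union>(c, r)\<in>S. ocube c r) \<le>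
      ennreal t * (\<Sum>q\<in>T. emeasure \<nu> (case q of (c, r) \<Rightarrow> ocube c (3 * r)))"
    by (rule mult_left_mono) simp
  also have "\<dots> = (\<Sum>(c, r)\<in>T. ennreal t * emeasure \<nu> (ocube c (3 * r)))"
    by (auto simp: sum_distrib_left intro!: sum.cong)
  also have "\<dots> \<le> (\<Sum>(c, r)\<in>T. 3 ^ CARD('n) * (\<integral>\<^sup>+z. h z * maximal \<nu> z * indicator (ocube c r) z \<partial>lborel))"
    using T(1) S by (intro sum_mono) (auto intro!: emeasure_ocube_weak \<nu> \<open>t > 0\<close>)
  also have "\<dots> = 3 ^ CARD('n) * (\<integral>\<^sup>+z. (\<Sum>(c, r)\<in>T. h z * maximal \<nu> z * indicator (ocube c r) z) \<partial>lborel)"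
    by (simp add: sum_distrib_left case_prod_unfold nn_integral_sum)
  also have "\<dots> = 3 ^ CARD('n) * (\<integral>\<^sup>+z. h z * maximal \<nu> z * (\<Sum>(c, r)\<in>T. indicator (ocube c r) z) \<partial>lborel)"
    by (simp add: sum_distrib_left case_prod_unfold)
  also have "\<dots> \<le> 3 ^ CARD('n) * (\<integral>\<^sup>+z. h z * maximal \<nu> z \<partial>lborel)"
  proof (intro mult_left_mono nn_integral_mono)
    fix z
    have "(\<Sum>(c, r)\<in>T. indicator (ocube c r) z) = (\<Sum>q\<in>T. indicator ((\<lambda>(c, r). ocube c r) q) z :: ennreal)"
      by (auto intro!: sum.cong)
    also have "\<dots> = indicator (\<Union>q\<in>T. (\<lambda>(c, r). ocube c r) q) z"
      by (rule indicator_UN_disjoint[OF fT T(2), symmetric])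
    also have "\<dots> \<le> (1::ennreal)" by (simp add: indicator_def)
    finally show "h z * maximal \<nu> z * (\<Sum>(c, r)\<in>T. indicator (ocube c r) z) \<le> h z * maximal \<nu> z"
      using mult_left_mono[of _ 1 "h z * maximal \<nu> z"] by simp
  qed simp
  finally show ?thesis .
qed

text \<open>The superlevel set is a union of open cubes on which \<open>h\<close> has a large
  average. Lindelof's theorem reduces it to countably many of them, and continuity from below to
  finitely many.\<close>

lemma weak_type:
  fixes \<nu> :: "(real ^ 'n::finite) measure" and h :: "real ^ 'n \<Rightarrow> ennreal"
  assumes \<nu>: "sets \<nu> = sets borel" and h: "h \<in> borel_measurable borel" and t: "t > 0"
  shows "ennreal t * emeasure \<nu> {x. ennreal t < maximal_fun h x} \<le>
    3 ^ CARD('n) * (\<integral>\<^sup>+z. h z * maximal \<nu> z \<partial>lborel)"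
proof -
  define F where "F = {(c, r). r > 0 \<and> ennreal (t * (2 * r) ^ CARD('n)) < emeasure (density lborel h) (ocube c r)}"
  define B :: "(real ^ 'n) \<times> real \<Rightarrow> (real ^ 'n) set" where "B = (\<lambda>(c, r). ocube c r)"
  have U: "{x. ennreal t < maximal_fun h x} = \<Union>(B ` F)"
    unfolding maximal_fun_def F_def B_def
    using t by (subst superlevel_maximal) auto
  have oB: "open (B q)" for q by (simp add: B_def open_ocube split: prod.split)
  obtain \<F> where \<F>: "\<F> \<subseteq> B ` F" "countable \<F>" "\<Union>\<F> = \<Union>(B ` F)"
    using Lindelof[of "B ` F"] oB by blast
  obtain G where G: "G \<subseteq> F" "countable G" "\<F> = B ` G"
    using \<F>(1,2) by (metis subset_image_inj countable_image_inj_eq)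
  show ?thesis
  proof (cases "G = {}")
    case True
    then have "{x. ennreal t < maximal_fun h x} = {}" using U \<F> G by auto
    then show ?thesis by simp
  next
    case False
    \<comment> \<open>Unions along an enumeration of \<open>G\<close>, which exists because
      \<open>G\<close> is nonempty; repetitions in \<open>from_nat_into G\<close> do no
      harm.\<close>
    define A where "A k = (\<Union>q\<in>from_nat_into G ` {..<k}. B q)" for k :: nat
    have "incseq A" unfolding A_def incseq_def by (intro allI impI UN_mono image_mono) auto
    moreover have "range A \<subseteq> sets \<nu>" unfolding A_def by (auto simp: \<nu> intro!: borel_open oB)
    ultimately have eq: "(SUP k. emeasure \<nu> (A k)) = emeasure \<nu> (\<Union>k. A k)"
      by (intro SUP_emeasure_incseq)
    have "(\<Union>k. A k) = (\<Union>q\<in>range (from_nat_into G). B q)"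
      by (auto simp: A_def)
    also have "\<dots> = {x. ennreal t < maximal_fun h x}"
      using G \<F>(3) U False by simp
    finally have "ennreal t * emeasure \<nu> {x. ennreal t < maximal_fun h x} = (SUP k. ennreal t * emeasure \<nu> (A k))"
      by (simp add: eq flip: SUP_mult_left_ennreal)
    also have "\<dots> \<le> 3 ^ CARD('n) * (\<integral>\<^sup>+z. h z * maximal \<nu> z \<partial>lborel)"
    proof (rule SUP_least)
      fix k
      have "from_nat_into G ` {..<k} \<subseteq> F"
        using G(1) from_nat_into[OF False] by blast
      then show "ennreal t * emeasure \<nu> (A k) \<le> 3 ^ CARD('n) * (\<integral>\<^sup>+z. h z * maximal \<nu> z \<partial>lborel)"
        unfolding A_def B_def
        by (intro weak_type_finite[OF \<nu> h t]) (auto simp: F_def subset_iff intro: less_imp_le)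
    qed
    finally show ?thesis .
  qed
qed

section \<open>The Fefferman--Stein inequality\<close>

text \<open>Follows from 2^a \<ge> 1 + a ln 2 and ln 2 \<ge> 1/2. It bounds the sums of the two
  geometric series below with the right growth as a tends to 0: \<open>a = p - 1\<close> yields p',
  and \<open>a = p * d\<close> with d = 1 - \<delta> yields 1/(1 - \<delta>).\<close>

lemma one_over_one_minus_two_powr_le:
  fixes a :: real
  assumes "a > 0"
  shows "1 / (1 - 2 powr (- a)) \<le> 2 * (a + 1) / a"
proof -
  have "ln (1/2::real) \<le> 1/2 - 1" by (rule ln_le_minus_one) simp
  then have "1/2 \<le> ln (2::real)" by (simp add: ln_div)
  then have "1 + a / 2 \<le> 1 + a * ln 2" using assms by simp
  also have "\<dots> \<le> 2 powr a" by (simp add: powr_def)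
  finally have "2 powr (- a) \<le> 1 / (1 + a / 2)"
    using assms by (simp add: powr_minus divide_simps)
  moreover have "1 - 1 / (1 + a / 2) = a / (2 + a)"
    using assms by (simp add: field_simps)
  moreover have "a / (2 * (a + 1)) \<le> a / (2 + a)"
    using assms by (intro divide_left_mono) auto
  ultimately have "a / (2 * (a + 1)) \<le> 1 - 2 powr (- a)" by linarith
  then have "1 / (1 - 2 powr (- a)) \<le> 1 / (a / (2 * (a + 1)))"
    using assms by (intro divide_left_mono mult_pos_pos)
      (auto simp: powr_less_one intro: less_le_trans[of 0 "a / (2 * (a + 1))"])
  then show ?thesis by simp
qed

text \<open>One term suffices, the one with 2^k < G \<le> 2^(k+1). For infinite \<open>G\<close> all
  terms are present and they are unbounded. The sum is an integral over counting measure so that it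
  can be exchanged with other integrals.\<close>

lemma epowr_le_dyadic_sum:
  fixes p :: real
  assumes "p > 0"
  shows "epowr G p \<le> (\<integral>\<^sup>+(k::int). ennreal (2 powr ((real_of_int k + 1) * p)) * indicator {k::int. ennreal (2 powr k) < G} k \<partial>count_space UNIV)"
    (is "_ \<le> (\<integral>\<^sup>+k. ?f k \<partial>_)")
proof -
  have term_le: "?f k \<le> (\<integral>\<^sup>+k. ?f k \<partial>count_space UNIV)" for k
    by (rule nn_integral_ge_point) simp
  show ?thesis
  proof (cases G)
    case (real s)
    show ?thesis
    proof (cases "s = 0")
      case False
      then have s: "s > 0" using real by simp
      \<comment> \<open>Ceiling minus one, not floor: the level must lie strictly below
        \<open>s\<close> even if \<open>s\<close> is a power of two.\<close>
      define k where "k = \<lceil>log 2 s\<rceil> - 1"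
      have k: "real_of_int k < log 2 s" "log 2 s \<le> real_of_int k + 1"
        unfolding k_def by linarith+
      have 1: "2 powr k < s" using k(1) s by (simp add: less_log_iff)
      have "s \<le> 2 powr (k + 1)" using k(2) s by (simp add: log_le_iff)
      then have "s powr p \<le> (2 powr (k + 1)) powr p"
        using assms s by (intro powr_mono2) auto
      then have "epowr G p \<le> ?f k"
        using 1 real s by (simp add: epowr_def powr_powr ennreal_less_iff)
      also note term_le
      finally show ?thesis .
    qed (simp add: real epowr_def)
  next
    case top
    have "of_nat N \<le> (\<integral>\<^sup>+k. ?f k \<partial>count_space UNIV)" for N :: nat
    proof -
      define k where "k = \<lceil>real N / p\<rceil>"
      have "real N / p \<le> k" unfolding k_def by (rule le_of_int_ceiling)
      then have "real N \<le> k * p" using assms by (simp add: pos_divide_le_eq)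
      then have "real N \<le> (real_of_int k + 1) * p" using assms by (simp add: algebra_simps)
      then have "2 powr real N \<le> 2 powr ((real_of_int k + 1) * p)" by (rule powr_mono) simp
      then have "real N \<le> 2 powr ((real_of_int k + 1) * p)"
        using of_nat_less_two_power[of N, where 'a=real] unfolding powr_realpow[OF zero_less_numeral] by linarith
      then have "ennreal (real N) \<le> ?f k" using top by (simp add: ennreal_leI)
      also note term_le
      finally show ?thesis by (simp add: ennreal_of_nat_eq_real_of_nat)
    qed
    then have "(\<integral>\<^sup>+k. ?f k \<partial>count_space UNIV) = top"
      by (meson ennreal_Ex_less_of_nat leD top.not_eq_extremum)
    then show ?thesis by simp
  qed
qed

text \<open>This is the sum over levels at one point where the function has the value
  \<open>s\<close>. The exponent is (k + 1) p from the k-th layer minus k - 1 from dividing by the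
  level of the weak type inequality. The terms grow like 2^(k (p - 1)), so for p > 1 the last
  admissible one dominates, and the geometric series of ratio 2^(-(p - 1)) produces p'.\<close>

lemma dyadic_sum_le:
  fixes p s :: real
  assumes p: "p > 1" and "s \<ge> 0"
  shows "(\<integral>\<^sup>+(k::int). ennreal (2 powr ((real_of_int k + 1) * p - (real_of_int k - 1))) * (ennreal s * indicator {k::int. 2 powr (real_of_int k - 1) < s} k) \<partial>count_space UNIV)
    \<le> ennreal (2 * 4 powr p * (p / (p - 1)) * s powr p)"
proof (cases "s = 0")
  case False
  then have s: "s > 0" using assms by simp
  define m where "m = \<lceil>log 2 s\<rceil>"
  define q where "q = 2 powr (- (p - 1))"
  have q: "0 < q" "q < 1" using p by (auto simp: q_def powr_less_one)
  have set_eq: "{k::int. 2 powr (real_of_int k - 1) < s} = {..m}"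
    using s by (auto simp: m_def le_ceiling_iff less_log_iff)
  have "(\<integral>\<^sup>+(k::int). ennreal (2 powr ((real_of_int k + 1) * p - (real_of_int k - 1))) * (ennreal s * indicator {k::int. 2 powr (real_of_int k - 1) < s} k) \<partial>count_space UNIV)
     = (\<integral>\<^sup>+(k::int). ennreal (2 powr ((real_of_int k + 1) * p - (real_of_int k - 1)) * s) \<partial>count_space {..m})"
    unfolding set_eq using s
    by (subst nn_integral_count_space_indicator) (auto simp: ennreal_mult mult_ac intro!: nn_integral_cong)
  also have "\<dots> = (\<integral>\<^sup>+(j::nat). ennreal (2 powr ((real_of_int (m - int j) + 1) * p - (real_of_int (m - int j) - 1)) * s) \<partial>count_space UNIV)"
  proof (rule nn_integral_bij_count_space[symmetric])
    show "bij_betw (\<lambda>j. m - int j) UNIV {..m}"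
      by (rule bij_betwI[of _ _ _ "\<lambda>k. nat (m - k)"]) auto
  qed
  also have "\<dots> = (\<Sum>j. ennreal (2 powr (m * (p - 1) + p + 1) * s * q ^ j))"
    unfolding nn_integral_count_space_nat
  proof (intro suminf_cong arg_cong[where f=ennreal])
    fix j :: nat
    have "2 powr ((real_of_int (m - int j) + 1) * p - (real_of_int (m - int j) - 1)) =
        2 powr ((m * (p - 1) + p + 1) + (- (p - 1)) * j)"
      by (rule arg_cong[where f="\<lambda>x. 2 powr x"]) (simp add: algebra_simps)
    also have "\<dots> = 2 powr (m * (p - 1) + p + 1) * q ^ j"
      unfolding powr_add q_def by (simp add: powr_powr flip: powr_realpow)
    finally show "2 powr ((real_of_int (m - int j) + 1) * p - (real_of_int (m - int j) - 1)) * s =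
        2 powr (m * (p - 1) + p + 1) * s * q ^ j" by simp
  qed
  also have "\<dots> = ennreal (2 powr (m * (p - 1) + p + 1) * s * (1 / (1 - q)))"
    using q s by (intro suminf_ennreal_eq sums_mult geometric_sums) auto
  also have "\<dots> \<le> ennreal (2 * 4 powr p * (p / (p - 1)) * s powr p)"
  proof (rule ennreal_leI)
    have "real_of_int m \<le> log 2 s + 1" unfolding m_def by linarith
    then have "m * (p - 1) + p + 1 \<le> (log 2 s + 1) * (p - 1) + p + 1"
      using p by (intro add_right_mono mult_right_mono) auto
    also have "\<dots> = log 2 s * (p - 1) + 2 * p" by (simp add: algebra_simps)
    finally have "2 powr (m * (p - 1) + p + 1) \<le> 2 powr (log 2 s * (p - 1) + 2 * p)"
      by (intro powr_mono) auto
    also have "\<dots> = s powr (p - 1) * 4 powr p"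
      using s by (simp add: powr_add flip: powr_powr)
    finally have 1: "2 powr (m * (p - 1) + p + 1) \<le> s powr (p - 1) * 4 powr p" .
    have 2: "1 / (1 - q) \<le> 2 * (p / (p - 1))"
      using one_over_one_minus_two_powr_le[of "p - 1"] p by (simp add: q_def)
    have "2 powr (m * (p - 1) + p + 1) * s * (1 / (1 - q)) \<le> s powr (p - 1) * 4 powr p * s * (2 * (p / (p - 1)))"
      using 1 2 s q p by (intro mult_mono) auto
    also have "\<dots> = 2 * 4 powr p * (p / (p - 1)) * s powr p"
      using s by (simp add: powr_diff)
    finally show "2 powr (m * (p - 1) + p + 1) * s * (1 / (1 - q)) \<le> 2 * 4 powr p * (p / (p - 1)) * s powr p" .
  qed
  finally show ?thesis .
qed simp

text \<open>On any cube, the part of \<open>f\<close> below \<open>t / 2\<close> contributes at most \<open>t / 2\<close> to the average.\<close>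

lemma superlevel_maximal_fun_truncate:
  fixes f :: "real ^ 'n::finite \<Rightarrow> real"
  assumes f [measurable]: "f \<in> borel_measurable borel" and t: "t > 0"
  shows "{x. ennreal t < maximal_fun (\<lambda>z. ennreal (f z)) x} \<subseteq>
    {x. ennreal (t / 2) < maximal_fun (\<lambda>z. ennreal (f z) * indicator {z. t / 2 < f z} z) x}"
proof safe
  fix x assume "ennreal t < maximal_fun (\<lambda>z. ennreal (f z)) x"
  then obtain c r where cr: "r > 0" "x \<in> ocube c r"
    "ennreal (t * (2 * r) ^ CARD('n)) < emeasure (density lborel (\<lambda>z. ennreal (f z))) (ocube c r)"
    unfolding maximal_fun_def using t by (auto elim!: less_maximalE)
  let ?h = "\<lambda>z. ennreal (f z) * indicator {z. t / 2 < f z} z"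
  have [measurable]: "ocube c r \<in> sets borel" by (simp add: open_ocube)
  show "ennreal (t / 2) < maximal_fun ?h x"
    unfolding maximal_fun_def
  proof (rule ennreal_less_maximalI[OF cr(1,2)])
    show "ennreal (t / 2 * (2 * r) ^ CARD('n)) < emeasure (density lborel ?h) (ocube c r)"
    proof (rule ccontr)
      assume "\<not> ennreal (t / 2 * (2 * r) ^ CARD('n)) < emeasure (density lborel ?h) (ocube c r)"
      then have small: "(\<integral>\<^sup>+z. ?h z * indicator (ocube c r) z \<partial>lborel) \<le> ennreal (t / 2 * (2 * r) ^ CARD('n))"
        by (simp add: emeasure_density)
      have "emeasure (density lborel (\<lambda>z. ennreal (f z))) (ocube c r) =
          (\<integral>\<^sup>+z. ennreal (f z) * indicator (ocube c r) z \<partial>lborel)"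
        by (simp add: emeasure_density)
      also have "\<dots> \<le> (\<integral>\<^sup>+z. ?h z * indicator (ocube c r) z + ennreal (t / 2) * indicator (ocube c r) z \<partial>lborel)"
        by (intro nn_integral_mono) (auto simp: indicator_def intro!: ennreal_leI)
      also have "\<dots> = (\<integral>\<^sup>+z. ?h z * indicator (ocube c r) z \<partial>lborel) + ennreal (t / 2) * emeasure lborel (ocube c r)"
        by (simp add: nn_integral_add nn_integral_cmult_indicator)
      also have "\<dots> \<le> ennreal (t / 2 * (2 * r) ^ CARD('n)) + ennreal (t / 2) * ennreal ((2 * r) ^ CARD('n))"
        using small by (simp add: emeasure_lborel_cube[OF cube_ocube[OF cr(1)]] add_right_mono)
      also have "\<dots> = ennreal (t * (2 * r) ^ CARD('n))"
        using t cr(1) by (simp flip: ennreal_mult ennreal_plus)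
      finally show False using cr(3) by simp
    qed
  qed (use t in simp)
qed

text \<open>Interpolation by hand: at level 2^k only the part of f above 2^(k-1) matters, and the
  weak type inequality is applied to that part at level 2^(k-1). Summing the truncated functions
  over k at each point restores f^p.\<close>

theorem Fefferman_Stein:
  fixes \<nu> :: "(real ^ 'n::finite) measure" and f :: "real ^ 'n \<Rightarrow> real"
  assumes \<nu>: "sets \<nu> = sets borel" and f [measurable]: "f \<in> borel_measurable borel"
    and f0: "\<And>x. f x \<ge> 0" and p: "p > 1"
  shows "(\<integral>\<^sup>+x. epowr (maximal_fun (\<lambda>z. ennreal (f z)) x) p \<partial>\<nu>) \<le>
    ennreal (3 ^ CARD('n) * (2 * 4 powr p * (p / (p - 1)))) *
    (\<integral>\<^sup>+x. ennreal (f x powr p) * maximal \<nu> x \<partial>lborel)"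
proof -
  let ?g = "maximal_fun (\<lambda>z. ennreal (f z))"
  let ?h = "\<lambda>(k::int) z. ennreal (f z) * indicator {z. 2 powr (real_of_int k - 1) < f z} z"
  let ?N = "3 ^ CARD('n) :: ennreal"
  have [measurable]: "?g \<in> borel_measurable borel" "maximal \<nu> \<in> borel_measurable borel"
    unfolding maximal_fun_def by (simp_all add: borel_measurable_maximal \<nu>)
  have [measurable]: "?g \<in> borel_measurable \<nu>"
    unfolding measurable_cong_sets[OF \<nu> refl] by measurable
  have "(\<integral>\<^sup>+x. epowr (?g x) p \<partial>\<nu>) \<le>
      (\<integral>\<^sup>+x. (\<integral>\<^sup>+(k::int). ennreal (2 powr ((real_of_int k + 1) * p)) * indicator {x. ennreal (2 powr k) < ?g x} x \<partial>count_space UNIV) \<partial>\<nu>)"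
    using epowr_le_dyadic_sum[of p] p by (intro nn_integral_mono) (simp add: indicator_def)
  \<comment> \<open>One of the integrals is a countable sum, so the exchange holds for every \<nu>,
    sigma-finite or not. The theorem can thus be applied to a measure whose density M\<nu> takes
    infinite values.\<close>
  also have "\<dots> = (\<integral>\<^sup>+(k::int). (\<integral>\<^sup>+x. ennreal (2 powr ((real_of_int k + 1) * p)) * indicator {x. ennreal (2 powr k) < ?g x} x \<partial>\<nu>) \<partial>count_space UNIV)"
    by (rule nn_integral_count_space_nn_integral) (auto simp: \<nu> cong: measurable_cong_sets)
  also have "\<dots> \<le> (\<integral>\<^sup>+(k::int). ennreal (2 powr ((real_of_int k + 1) * p - (real_of_int k - 1))) * (?N * (\<integral>\<^sup>+z. ?h k z * maximal \<nu> z \<partial>lborel)) \<partial>count_space UNIV)"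
  proof (intro nn_integral_mono)
    fix k :: int
    have half: "2 powr k / 2 = 2 powr (real_of_int k - 1)" by (simp add: powr_diff)
    have "{x. ennreal (2 powr k) < ?g x} \<subseteq> {x. ennreal (2 powr (real_of_int k - 1)) < maximal_fun (?h k) x}"
      using superlevel_maximal_fun_truncate[OF f, of "2 powr k"] unfolding half by simp
    then have "emeasure \<nu> {x. ennreal (2 powr k) < ?g x} \<le> emeasure \<nu> {x. ennreal (2 powr (real_of_int k - 1)) < maximal_fun (?h k) x}"
      by (rule emeasure_mono)
        (simp add: \<nu> maximal_fun_def open_superlevel_maximal borel_open)
    then have "ennreal (2 powr (real_of_int k - 1)) * emeasure \<nu> {x. ennreal (2 powr k) < ?g x} \<le>
        ennreal (2 powr (real_of_int k - 1)) * emeasure \<nu> {x. ennreal (2 powr (real_of_int k - 1)) < maximal_fun (?h k) x}"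
      by (rule mult_left_mono) simp
    also have "\<dots> \<le> ?N * (\<integral>\<^sup>+z. ?h k z * maximal \<nu> z \<partial>lborel)"
      by (rule weak_type[OF \<nu>]) auto
    finally have *: "ennreal (2 powr (real_of_int k - 1)) * emeasure \<nu> {x. ennreal (2 powr k) < ?g x} \<le> \<dots>" .
    \<comment> \<open>Splits off the level 2^(k-1) by which the weak type inequality is to be
      divided.\<close>
    have sp: "ennreal (2 powr ((real_of_int k + 1) * p)) = ennreal (2 powr ((real_of_int k + 1) * p - (real_of_int k - 1))) * ennreal (2 powr (real_of_int k - 1))"
      by (simp flip: ennreal_mult powr_add)
    have "(\<integral>\<^sup>+x. ennreal (2 powr ((real_of_int k + 1) * p)) * indicator {x. ennreal (2 powr k) < ?g x} x \<partial>\<nu>) =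
        ennreal (2 powr ((real_of_int k + 1) * p)) * emeasure \<nu> {x. ennreal (2 powr k) < ?g x}"
      by (rule nn_integral_cmult_indicator)
        (simp add: \<nu> maximal_fun_def open_superlevel_maximal borel_open)
    also have "\<dots> \<le> ennreal (2 powr ((real_of_int k + 1) * p - (real_of_int k - 1))) * (?N * (\<integral>\<^sup>+z. ?h k z * maximal \<nu> z \<partial>lborel))"
      unfolding sp by (subst mult.assoc) (rule mult_left_mono[OF *], simp)
    finally show "(\<integral>\<^sup>+x. ennreal (2 powr ((real_of_int k + 1) * p)) * indicator {x. ennreal (2 powr k) < ?g x} x \<partial>\<nu>) \<le> \<dots>" .
  qed
  also have "\<dots> = (\<integral>\<^sup>+(k::int). (\<integral>\<^sup>+z. ennreal (2 powr ((real_of_int k + 1) * p - (real_of_int k - 1))) * (?N * (?h k z * maximal \<nu> z)) \<partial>lborel) \<partial>count_space UNIV)"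
    by (simp add: nn_integral_cmult)
  also have "\<dots> = (\<integral>\<^sup>+z. (\<integral>\<^sup>+(k::int). ennreal (2 powr ((real_of_int k + 1) * p - (real_of_int k - 1))) * (?N * (?h k z * maximal \<nu> z)) \<partial>count_space UNIV) \<partial>lborel)"
    by (rule nn_integral_count_space_nn_integral[symmetric]) auto
  also have "\<dots> = (\<integral>\<^sup>+z. (\<integral>\<^sup>+(k::int). ennreal (2 powr ((real_of_int k + 1) * p - (real_of_int k - 1))) * (ennreal (f z) * indicator {k::int. 2 powr (real_of_int k - 1) < f z} k) \<partial>count_space UNIV) * (?N * maximal \<nu> z) \<partial>lborel)"
    by (intro nn_integral_cong, subst nn_integral_multc[symmetric])
      (auto intro!: nn_integral_cong simp: indicator_def mult_ac)
  also have "\<dots> \<le> (\<integral>\<^sup>+z. ennreal (2 * 4 powr p * (p / (p - 1)) * f z powr p) * (?N * maximal \<nu> z) \<partial>lborel)"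
    by (intro nn_integral_mono mult_right_mono dyadic_sum_le p f0) auto
  also have "\<dots> = (\<integral>\<^sup>+z. ennreal (3 ^ CARD('n) * (2 * 4 powr p * (p / (p - 1)))) * (ennreal (f z powr p) * maximal \<nu> z) \<partial>lborel)"
  proof (intro nn_integral_cong)
    fix z
    have N: "?N = ennreal (3 ^ CARD('n))" by (simp add: ennreal_power flip: ennreal_numeral)
    have K: "0 \<le> 2 * 4 powr p * (p / (p - 1))" using p by simp
    show "ennreal (2 * 4 powr p * (p / (p - 1)) * f z powr p) * (?N * maximal \<nu> z) =
        ennreal (3 ^ CARD('n) * (2 * 4 powr p * (p / (p - 1)))) * (ennreal (f z powr p) * maximal \<nu> z)"
      unfolding N ennreal_mult[OF K powr_ge_zero] ennreal_mult[OF zero_le_power[OF zero_le_numeral] K]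
      by (simp add: mult_ac)
  qed
  also have "\<dots> = ennreal (3 ^ CARD('n) * (2 * 4 powr p * (p / (p - 1)))) * (\<integral>\<^sup>+x. ennreal (f x powr p) * maximal \<nu> x \<partial>lborel)"
    by (rule nn_integral_cmult) simp
  finally show ?thesis .
qed

section \<open>The kernel estimate\<close>

lemma ex_dyadic_scale:
  fixes s l :: real
  assumes "0 < s" "s \<le> l"
  shows "\<exists>k::nat. l / 2 ^ k / 2 < s \<and> s \<le> l / 2 ^ k"
proof -
  define k where "k = nat \<lfloor>log 2 (l / s)\<rfloor>"
  have "0 \<le> log 2 (l / s)" using assms by (simp add: zero_le_log_cancel_iff)
  then have "real k \<le> log 2 (l / s)" "log 2 (l / s) < real (Suc k)"
    unfolding k_def by linarith+
  then have "2 powr real k \<le> l / s" "l / s < 2 powr real (Suc k)"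
    using assms by (simp_all add: le_log_iff log_less_iff)
  then have "2 ^ k \<le> l / s" "l / s < 2 ^ Suc k"
    unfolding powr_realpow[OF zero_less_numeral] by auto
  then show ?thesis
    using assms by (intro exI[of _ k]) (simp add: field_simps)
qed

lemma ennreal_le_suminf: "f k \<le> (\<Sum>k. f k)" for f :: "nat \<Rightarrow> ennreal"
  using sum_le_suminf[of f "{k}"] by simp

text \<open>Points x are sorted by their sup-norm distance to y, between q_k / 2 and q_k with q_k =
  l / 2^k. The exponent p d - n may have either sign, so |x - y|^(p d) is estimated from above and
  |x - y|^n from below separately. Cubes of side 4 q_k around y have \<nu>-mass at most M\<nu>(y) (4
  q_k)^n, and a geometric series of ratio 2^(-p d) remains.\<close>

lemma nn_integral_kernel_le:
  fixes \<nu> :: "(real ^ 'n::finite) measure" and p d l :: real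
  assumes \<nu>: "sets \<nu> = sets borel" and Q: "cube l Q" and y: "y \<in> Q" and p: "p > 1" and d: "0 < d" "d < 1"
  shows "(\<integral>\<^sup>+x. indicator Q x * ennreal (norm (x - y) powr (p * d - CARD('n))) \<partial>\<nu>) \<le>
    ennreal (CARD('n) powr p * 8 ^ CARD('n) * (4 / d) * l powr (p * d)) * maximal \<nu> y"
proof -
  define a where "a = p * d"
  define N where "N = real CARD('n)"
  define q where "q k = l / 2 ^ k" for k :: nat
  \<comment> \<open>Comparing the Euclidean norm with the sup norm costs \<open>N powr a\<close>;
    the larger \<open>N powr p\<close> is a p-th power of a dimensional constant.\<close>
  define c where "c k = N powr p * q k powr a / (q k / 2) ^ CARD('n)" for k
  have l: "l > 0" using Q by (simp add: cube_def)
  have a: "a > 0" "a \<le> p" using p d by (auto simp: a_def)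
  have N: "N \<ge> 1" by (simp add: N_def Suc_leI)
  have q: "q k > 0" for k using l by (simp add: q_def)
  have c0: "c k \<ge> 0" for k using q by (simp add: c_def less_imp_le)
  have pt: "indicator Q x * ennreal (norm (x - y) powr (a - N)) \<le> (\<Sum>k. ennreal (c k) * indicator (ocube y (2 * q k)) x)" for x
  \<comment> \<open>At \<open>x = y\<close> the kernel has the value \<open>0 powr _ = 0\<close>, so
    a point mass of \<nu> at y contributes nothing.\<close>
  proof (cases "x \<in> Q \<and> x \<noteq> y")
    case True
    define s where "s = infnorm (x - y)"
    have s0: "s > 0" using True by (simp add: s_def infnorm_pos_lt)
    have comp: "\<bar>x $ i - y $ i\<bar> \<le> s" for i
      using component_le_infnorm_cart[of "x - y" i] by (simp add: s_def)
    have "s \<le> l"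
      unfolding s_def infnorm_cart using cube_diff_le[OF Q _ y] True by (intro cSup_least) auto
    then obtain k where k: "q k / 2 < s" "s \<le> q k"
      using ex_dyadic_scale[OF s0] by (auto simp: q_def)
    have n1: "s \<le> norm (x - y)" by (simp add: s_def infnorm_le_norm)
    have n2: "norm (x - y) \<le> N * s"
      using sum_bounded_above[of UNIV "\<lambda>i. \<bar>(x - y) $ i\<bar>" s] norm_le_l1_cart[of "x - y"] comp
      by (simp add: N_def)
    have "norm (x - y) powr (a - N) = norm (x - y) powr a / norm (x - y) powr N"
      by (simp add: powr_diff)
    also have "norm (x - y) powr N = norm (x - y) ^ CARD('n)"
      using True by (simp add: N_def powr_realpow)
    also have "norm (x - y) powr a / norm (x - y) ^ CARD('n) \<le> (N powr p * q k powr a) / (q k / 2) ^ CARD('n)"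
    proof (rule frac_le)
      have "norm (x - y) powr a \<le> (N * q k) powr a"
        using n2 k(2) N a by (intro powr_mono2) (auto intro: order.trans[OF n2] mult_left_mono)
      also have "\<dots> = N powr a * q k powr a" using N q[of k] by (simp add: powr_mult)
      also have "\<dots> \<le> N powr p * q k powr a" using N a by (intro mult_right_mono powr_mono) auto
      finally show "norm (x - y) powr a \<le> N powr p * q k powr a" .
      show "(q k / 2) ^ CARD('n) \<le> norm (x - y) ^ CARD('n)"
        using k(1) n1 q[of k] by (intro power_mono) auto
    qed (use q[of k] in auto)
    finally have "norm (x - y) powr (a - N) \<le> c k" by (simp add: c_def)
    \<comment> \<open>Twice the radius, because the distance may equal \<open>q k\<close> and
      \<open>ocube\<close> is open.\<close>
    moreover have "x \<in> ocube y (2 * q k)"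
      unfolding ocube_def using k(2) q[of k] by (auto intro: le_less_trans[OF comp])
    ultimately have "indicator Q x * ennreal (norm (x - y) powr (a - N)) \<le> ennreal (c k) * indicator (ocube y (2 * q k)) x"
      using True by (simp add: ennreal_leI)
    also have "\<dots> \<le> (\<Sum>k. ennreal (c k) * indicator (ocube y (2 * q k)) x)"
      by (rule ennreal_le_suminf)
    finally show ?thesis .
  qed auto
  have ycube: "y \<in> ocube y (2 * q k)" for k using q by (simp add: ocube_def)
  have const: "(\<Sum>k. ennreal (c k * (4 * q k) ^ CARD('n))) \<le> ennreal (N powr p * 8 ^ CARD('n) * (4 / d) * l powr a)"
  proof -
    have ck: "c k * (4 * q k) ^ CARD('n) = N powr p * 8 ^ CARD('n) * l powr a * (2 powr (- a)) ^ k" for k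
    proof -
      have "(4 * q k) ^ CARD('n) = 8 ^ CARD('n) * (q k / 2) ^ CARD('n)"
        by (subst power_mult_distrib[symmetric]) simp
      moreover have "q k powr a = l powr a * (2 powr (- a)) ^ k"
      proof -
        have "(2 ^ k) powr a = (2 powr a) ^ k" by (simp add: powr_powr mult.commute flip: powr_realpow)
        then show ?thesis using l by (simp add: q_def powr_divide powr_minus inverse_eq_divide power_one_over)
      qed
      moreover have "(q k / 2) ^ CARD('n) \<noteq> 0" using q[of k] by simp
      ultimately show ?thesis by (simp add: c_def)
    qed
    have r: "0 < 2 powr (- a)" "2 powr (- a) < 1" using a by (auto simp: powr_less_one)
    have "(\<Sum>k. ennreal (c k * (4 * q k) ^ CARD('n))) = ennreal (N powr p * 8 ^ CARD('n) * l powr a * (1 / (1 - 2 powr (- a))))"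
      unfolding ck using r by (intro suminf_ennreal_eq sums_mult geometric_sums) auto
    also have "\<dots> \<le> ennreal (N powr p * 8 ^ CARD('n) * l powr a * (4 / d))"
    proof (intro ennreal_leI mult_left_mono)
      have "1 / (1 - 2 powr (- a)) \<le> 2 * (a + 1) / a" by (rule one_over_one_minus_two_powr_le[OF a(1)])
      also have "\<dots> = 2 + 2 / a" using a by (simp add: field_simps)
      also have "\<dots> \<le> 2 / d + 2 / d"
        using p d by (intro add_mono) (auto simp: a_def divide_simps)
      finally show "1 / (1 - 2 powr (- a)) \<le> 4 / d" by simp
    qed auto
    finally show ?thesis by (simp add: mult_ac)
  qed
  have "(\<integral>\<^sup>+x. indicator Q x * ennreal (norm (x - y) powr (a - N)) \<partial>\<nu>) \<le>
      (\<integral>\<^sup>+x. (\<Sum>k. ennreal (c k) * indicator (ocube y (2 * q k)) x) \<partial>\<nu>)"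
    by (intro nn_integral_mono pt)
  also have "\<dots> = (\<Sum>k. ennreal (c k) * emeasure \<nu> (ocube y (2 * q k)))"
    by (subst nn_integral_suminf) (auto simp: \<nu> open_ocube nn_integral_cmult_indicator cong: measurable_cong_sets)
  also have "\<dots> \<le> (\<Sum>k. ennreal (c k * (4 * q k) ^ CARD('n)) * maximal \<nu> y)"
  proof (intro suminf_le summableI)
    fix k
    have "ennreal (c k) * emeasure \<nu> (ocube y (2 * q k)) \<le> ennreal (c k) * (maximal \<nu> y * ennreal ((4 * q k) ^ CARD('n)))"
      using emeasure_le_maximal[OF cube_ocube[of "2 * q k" y] ycube, of \<nu>] q[of k] by (intro mult_left_mono) auto
    then show "ennreal (c k) * emeasure \<nu> (ocube y (2 * q k)) \<le> ennreal (c k * (4 * q k) ^ CARD('n)) * maximal \<nu> y"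
      using c0[of k] q[of k] by (simp add: ennreal_mult mult_ac)
  qed
  also have "\<dots> \<le> ennreal (N powr p * 8 ^ CARD('n) * (4 / d) * l powr a) * maximal \<nu> y"
    unfolding ennreal_suminf_multc by (rule mult_right_mono[OF const]) simp
  finally show ?thesis by (simp add: a_def N_def)
qed

section \<open>A pointwise estimate for differences\<close>

text \<open>The interval starts at the smaller point if that lies in the left half of
  \<open>I\<close>, and otherwise ends at the larger one. Since \<open>r < l / 2\<close>, for
  positive \<open>r\<close> the other end falls in the open interior, so it does not matter which
  endpoints \<open>I\<close> contains.\<close>

lemma subinterval_ex:
  fixes x y :: real
  assumes "interval_of_length l I" "x \<in> I" "y \<in> I" "\<bar>x - y\<bar> \<le> r" "r < l / 2"
  shows "\<exists>b. {b..b+r} \<subseteq> I \<and> x \<in> {b..b+r} \<and> y \<in> {b..b+r}"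
proof -
  obtain a where a: "{a<..<a+l} \<subseteq> I" "I \<subseteq> {a..a+l}" "convex I"
    using interval_of_lengthE[OF assms(1)] by metis
  have iv: "is_interval I" using a(3) by (simp add: is_interval_convex_1)
  have seg: "{v..w} \<subseteq> I" if "v \<in> I" "w \<in> I" for v w
    using mem_is_interval_1_I[OF iv that] by auto
  have r: "r \<ge> 0" using assms(4) by linarith
  show ?thesis
  proof (cases "min x y < a + l / 2")
    case True
    have m: "min x y \<in> I" using assms(2,3) by (simp add: min_def)
    then have "min x y \<ge> a" using a(2) by (meson atLeastAtMost_iff subset_iff)
    then have "r = 0 \<or> min x y + r \<in> {a<..<a+l}" using True assms(5) r by auto
    then have "min x y + r \<in> I" using m a(1) by auto
    then have "{min x y..min x y + r} \<subseteq> I" using m by (intro seg)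
    then show ?thesis
      using assms(4) by (intro exI[of _ "min x y"] conjI) (auto simp: min_def abs_if split: if_splits)
  next
    case False
    have M: "max x y \<in> I" using assms(2,3) by (simp add: max_def)
    then have "max x y \<le> a + l" using a(2) by (meson atLeastAtMost_iff subset_iff)
    then have "r = 0 \<or> max x y - r \<in> {a<..<a+l}" using False assms(5) r by auto
    then have "max x y - r \<in> I" using M a(1) by auto
    then have "{max x y - r..max x y} \<subseteq> I" using M by (intro seg)
    then show ?thesis
      using assms(4) by (intro exI[of _ "max x y - r"] conjI) (auto simp: max_def abs_if split: if_splits)
  qed
qed

text \<open>For close points an interval of length |x - y| is chosen in each coordinate, which is
  possible because the coordinates differ by at most that much. For distant points \<open>Q\<close>
  itself serves, and this is where the factor 2 arises.\<close>

lemma subcube_ex: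
  fixes x y :: "real ^ 'n::finite"
  assumes Q: "cube l Q" and xy: "x \<in> Q" "y \<in> Q" "x \<noteq> y"
  shows "\<exists>s Q'. cube s Q' \<and> Q' \<subseteq> Q \<and> x \<in> Q' \<and> y \<in> Q' \<and> s \<le> 2 * norm (x - y)"
proof (cases "norm (x - y) < l / 2")
  case True
  obtain I where I: "\<And>i. interval_of_length l (I i)" and Q': "Q = {x. \<forall>i. x $ i \<in> I i}"
    using Q by (auto simp: cube_def)
  have "\<exists>b. {b..b + norm (x - y)} \<subseteq> I i \<and> x $ i \<in> {b..b + norm (x - y)} \<and> y $ i \<in> {b..b + norm (x - y)}" for i
    using xy component_le_norm_cart[of "x - y" i] True by (intro subinterval_ex[OF I]) (auto simp: Q')
  then obtain b where b: "\<And>i. {b i..b i + norm (x - y)} \<subseteq> I i"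
    "\<And>i. x $ i \<in> {b i..b i + norm (x - y)}" "\<And>i. y $ i \<in> {b i..b i + norm (x - y)}"
    by metis
  show ?thesis
  proof (intro exI conjI)
    show "cube (norm (x - y)) {x'. \<forall>i. x' $ i \<in> {b i..b i + norm (x - y)}}"
      using xy(3) unfolding cube_def interval_of_length_def
      by (intro conjI exI[of _ "\<lambda>i. {b i..b i + norm (x - y)}"]) auto
    show "{x'. \<forall>i. x' $ i \<in> {b i..b i + norm (x - y)}} \<subseteq> Q"
      using b(1) unfolding Q' by blast
  qed (use b in auto)
next
  case False
  then show ?thesis using Q xy by (intro exI[of _ l] exI[of _ Q]) auto
qed

text \<open>The set is the image of \<open>Q\<close> under the homothety with centre
  \<open>x\<close> and ratio \<open>t\<close>, written as a preimage; each of the four shapes of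
  interval is preserved.\<close>

lemma cube_dilation:
  fixes Q :: "(real ^ 'n::finite) set"
  assumes "cube s Q" and t: "t > 0"
  shows "cube (t * s) {w. x + (1 / t) *\<^sub>R (w - x) \<in> Q}"
proof -
  obtain I where s: "s > 0" and I: "\<And>i. interval_of_length s (I i)" and Q: "Q = {x. \<forall>i. x $ i \<in> I i}"
    using assms(1) by (auto simp: cube_def)
  have "interval_of_length (t * s) {w. v + (w - v) / t \<in> J}" if J: "interval_of_length s J" for v J
  proof -
    obtain a where a: "J = {a..a+s} \<or> J = {a<..<a+s} \<or> J = {a..<a+s} \<or> J = {a<..a+s}"
      using J by (auto simp: interval_of_length_def)
    define b where "b = v + t * (a - v)"
    have "a \<le> v + (w - v) / t \<longleftrightarrow> b \<le> w" "a < v + (w - v) / t \<longleftrightarrow> b < w"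
      "v + (w - v) / t \<le> a + s \<longleftrightarrow> w \<le> b + t * s" "v + (w - v) / t < a + s \<longleftrightarrow> w < b + t * s" for w
      using t by (simp_all add: b_def field_simps)
    then have "{w. v + (w - v) / t \<in> {a..a+s}} = {b..b + t * s}" "{w. v + (w - v) / t \<in> {a<..<a+s}} = {b<..<b + t * s}"
      "{w. v + (w - v) / t \<in> {a..<a+s}} = {b..<b + t * s}" "{w. v + (w - v) / t \<in> {a<..a+s}} = {b<..b + t * s}"
      by auto
    then show ?thesis
      using a unfolding interval_of_length_def by metis
  qed
  then show ?thesis
    unfolding cube_def using s t I
    by (intro conjI exI[of _ "\<lambda>i. {w. x $ i + (w - x $ i) / t \<in> I i}"]) (auto simp: Q)
qed

lemma nn_integral_lborel_affine:
  fixes f :: "'a::euclidean_space \<Rightarrow> ennreal"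
  assumes [measurable]: "f \<in> borel_measurable borel" and c: "c \<noteq> 0"
  shows "(\<integral>\<^sup>+w. f w \<partial>lborel) = ennreal (\<bar>c\<bar> ^ DIM('a)) * (\<integral>\<^sup>+z. f (v + c *\<^sub>R z) \<partial>lborel)"
proof -
  have "(\<integral>\<^sup>+w. f w \<partial>lborel) =
      (\<integral>\<^sup>+w. f w \<partial>density (distr lborel borel (\<lambda>z. v + c *\<^sub>R z)) (\<lambda>_. ennreal (\<bar>c\<bar> ^ DIM('a))))"
    by (rule arg_cong[OF lborel_affine[OF c]])
  then show ?thesis
    by (simp add: nn_integral_density nn_integral_distr nn_integral_cmult)
qed

text \<open>For \<open>0 < t \<le> 1\<close> the map \<open>z \<mapsto> x + t (z - x)\<close> sends \<open>Q\<close> to a cube that still contains \<open>x\<close>,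
  so that averages along rays need no Riesz potential.\<close>

lemma nn_integral_rays_le:
  fixes f :: "real ^ 'n::finite \<Rightarrow> ennreal"
  assumes f [measurable]: "f \<in> borel_measurable borel" and Q: "cube s Q" "x \<in> Q"
  shows "(\<integral>\<^sup>+z. indicator Q z * (\<integral>\<^sup>+t. f (x + t *\<^sub>R (z - x)) * indicator {0..1::real} t \<partial>lborel) \<partial>lborel)
    \<le> maximal_fun f x * ennreal (s ^ CARD('n))"
proof -
  have [measurable]: "Q \<in> sets borel" using Q cube_sets_borel by blast
  have s: "s > 0" using Q by (simp add: cube_def)
  have inner: "(\<integral>\<^sup>+z. indicator Q z * f (x + t *\<^sub>R (z - x)) \<partial>lborel) \<le> maximal_fun f x * ennreal (s ^ CARD('n))" if t: "t > 0" for t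
  proof -
    let ?Q = "{w. x + (1 / t) *\<^sub>R (w - x) \<in> Q}"
    have Qt: "cube (t * s) ?Q" "x \<in> ?Q" using cube_dilation[OF Q(1) t] Q(2) by auto
    have [measurable]: "?Q \<in> sets borel" using Qt cube_sets_borel by blast
    have eq: "x - t *\<^sub>R x + t *\<^sub>R z = x + t *\<^sub>R (z - x)" for z by (simp add: algebra_simps)
    have "ennreal (t ^ CARD('n)) * (\<integral>\<^sup>+z. indicator Q z * f (x + t *\<^sub>R (z - x)) \<partial>lborel) =
        ennreal (\<bar>t\<bar> ^ DIM(real ^ 'n)) * (\<integral>\<^sup>+z. f (x - t *\<^sub>R x + t *\<^sub>R z) * indicator ?Q (x - t *\<^sub>R x + t *\<^sub>R z) \<partial>lborel)"
      unfolding eq using t by (simp add: indicator_def mult.commute)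
    also have "\<dots> = (\<integral>\<^sup>+w. f w * indicator ?Q w \<partial>lborel)"
      using t by (intro nn_integral_lborel_affine[symmetric]) auto
    also have "\<dots> = emeasure (density lborel f) ?Q" by (simp add: emeasure_density)
    also have "\<dots> \<le> maximal_fun f x * ennreal ((t * s) ^ CARD('n))"
      unfolding maximal_fun_def by (rule emeasure_le_maximal[OF Qt])
    also have "\<dots> = ennreal (t ^ CARD('n)) * (maximal_fun f x * ennreal (s ^ CARD('n)))"
      using t s by (simp add: power_mult_distrib ennreal_mult mult_ac)
    finally show ?thesis using t by (subst (asm) ennreal_mult_le_mult_iff) auto
  qed
  have "(\<integral>\<^sup>+z. indicator Q z * (\<integral>\<^sup>+t. f (x + t *\<^sub>R (z - x)) * indicator {0..1::real} t \<partial>lborel) \<partial>lborel) =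
      (\<integral>\<^sup>+z. (\<integral>\<^sup>+t. indicator Q z * (f (x + t *\<^sub>R (z - x)) * indicator {0..1::real} t) \<partial>lborel) \<partial>lborel)"
    by (simp add: nn_integral_cmult)
  also have "\<dots> = (\<integral>\<^sup>+t. (\<integral>\<^sup>+z. indicator Q z * (f (x + t *\<^sub>R (z - x)) * indicator {0..1::real} t) \<partial>lborel) \<partial>lborel)"
    by (rule lborel_pair.Fubini') measurable
  also have "\<dots> = (\<integral>\<^sup>+t. (\<integral>\<^sup>+z. indicator Q z * f (x + t *\<^sub>R (z - x)) \<partial>lborel) * indicator {0..1::real} t \<partial>lborel)"
    by (simp add: nn_integral_multc flip: mult.assoc)
  also have "\<dots> \<le> (\<integral>\<^sup>+t. maximal_fun f x * ennreal (s ^ CARD('n)) * indicator {0..1::real} t \<partial>lborel)"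
    using AE_lborel_singleton[of "0::real"]
    by (intro nn_integral_mono_AE) (auto elim!: eventually_mono simp: inner split: split_indicator)
  also have "\<dots> = maximal_fun f x * ennreal (s ^ CARD('n))"
    by (simp add: nn_integral_cmult_indicator)
  finally show ?thesis .
qed

section \<open>From the gradient on segments to the maximal function\<close>

lemma C1_on_diff_le:
  fixes u :: "real ^ 'n::finite \<Rightarrow> real"
  assumes u: "C1_on Q u" and Q: "convex Q" and xz: "x \<in> Q" "z \<in> Q"
  shows "ennreal \<bar>u x - u z\<bar> \<le> ennreal (norm (z - x)) *
    (\<integral>\<^sup>+t. ennreal (indicator Q (x + t *\<^sub>R (z - x)) * norm (gradient_on Q u (x + t *\<^sub>R (z - x)))) * indicator {0..1} t \<partial>lborel)"
proof -
  let ?\<gamma> = "\<lambda>t. x + t *\<^sub>R (z - x)"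
  let ?G = "gradient_on Q u"
  have \<gamma>: "?\<gamma> t \<in> Q" if "t \<in> {0..1}" for t
    using convexD_alt[OF Q xz, of t] that by (simp add: algebra_simps)
  have D: "(u has_derivative (\<lambda>h. ?G w \<bullet> h)) (at w within Q)" if "w \<in> Q" for w
  proof -
    let ?D = "frechet_derivative u (at w within Q)"
    have der: "(u has_derivative ?D) (at w within Q)"
      using u that by (simp add: C1_on_def differentiable_on_def frechet_derivative_works)
    then have "linear ?D" by (rule has_derivative_linear)
    then have "?D h = ?G w \<bullet> h" for h
    proof -
      have "?D h = ?D (\<Sum>i\<in>UNIV. h $ i *s axis i 1)" by (simp add: basis_expansion)
      also have "\<dots> = (\<Sum>i\<in>UNIV. h $ i * ?D (axis i 1))"
        using \<open>linear ?D\<close> by (simp add: linear_sum linear_cmul scalar_mult_eq_scaleR)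
      also have "\<dots> = ?G w \<bullet> h"
        by (simp add: gradient_on_def inner_vec_def mult.commute)
      finally show ?thesis .
    qed
    then show ?thesis using der by (metis (no_types, lifting) ext)
  qed
  have "((\<lambda>t. u (?\<gamma> t)) has_vector_derivative ?G (?\<gamma> t) \<bullet> (z - x)) (at t within {0..1})" if t: "t \<in> {0..1}" for t
  proof -
    have 1: "(?\<gamma> has_derivative (\<lambda>h. h *\<^sub>R (z - x))) (at t within {0..1})"
      by (auto intro!: derivative_eq_intros)
    \<comment> \<open>The derivative within \<open>Q\<close> restricts to the segment, which lies in
      \<open>Q\<close> by convexity, so boundary points of \<open>Q\<close> need no separate
      treatment.\<close>
    have 2: "(u has_derivative (\<lambda>h. ?G (?\<gamma> t) \<bullet> h)) (at (?\<gamma> t) within ?\<gamma> ` {0..1})"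
      using \<gamma> t by (intro has_derivative_subset[OF D]) auto
    show ?thesis
      using has_derivative_in_compose[OF 1 2] by (simp add: has_vector_derivative_def)
  qed
  then have I: "((\<lambda>t. ?G (?\<gamma> t) \<bullet> (z - x)) has_integral u (?\<gamma> 1) - u (?\<gamma> 0)) {0..1}"
    by (intro fundamental_theorem_of_calculus) auto
  have cont: "continuous_on {0..1} (\<lambda>t. ?G (?\<gamma> t))"
    using u \<gamma> unfolding C1_on_def
    by (intro continuous_on_compose2[of Q ?G "{0..1}" ?\<gamma>] continuous_intros) auto
  have cont': "continuous_on {0..1} (\<lambda>t. norm (z - x) * norm (?G (?\<gamma> t)))"
    using cont by (intro continuous_intros)
  then have J: "((\<lambda>t. norm (z - x) * norm (?G (?\<gamma> t))) has_integral integral {0..1} (\<lambda>t. norm (z - x) * norm (?G (?\<gamma> t)))) {0..1}"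
    by (intro integrable_integral integrable_continuous_real)
  have "norm (integral {0..1} (\<lambda>t. ?G (?\<gamma> t) \<bullet> (z - x))) \<le> integral {0..1} (\<lambda>t. norm (z - x) * norm (?G (?\<gamma> t)))"
  proof (rule integral_norm_bound_integral[OF has_integral_integrable[OF I] has_integral_integrable[OF J]])
    fix t
    show "norm (?G (?\<gamma> t) \<bullet> (z - x)) \<le> norm (z - x) * norm (?G (?\<gamma> t))"
      using Cauchy_Schwarz_ineq2[of "?G (?\<gamma> t)" "z - x"] by (simp add: mult.commute)
  qed
  then have "\<bar>u x - u z\<bar> \<le> integral {0..1} (\<lambda>t. norm (z - x) * norm (?G (?\<gamma> t)))"
    using integral_unique[OF I] by simp
  then have "ennreal \<bar>u x - u z\<bar> \<le> ennreal (integral {0..1} (\<lambda>t. norm (z - x) * norm (?G (?\<gamma> t))))"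
    by (rule ennreal_leI)
  also have "\<dots> = (\<integral>\<^sup>+t. ennreal (norm (z - x) * norm (?G (?\<gamma> t))) * indicator {0..1} t \<partial>lborel)"
    by (rule nn_integral_has_integral_lebesgue'[OF _ J, symmetric]) simp
  also have "\<dots> = (\<integral>\<^sup>+t. ennreal (norm (z - x)) * (ennreal (indicator Q (?\<gamma> t) * norm (?G (?\<gamma> t))) * indicator {0..1} t) \<partial>lborel)"
    using \<gamma> by (intro nn_integral_cong) (auto simp: indicator_def ennreal_mult)
  also have "\<dots> = ennreal (norm (z - x)) * (\<integral>\<^sup>+t. ennreal (indicator Q (?\<gamma> t) * norm (?G (?\<gamma> t))) * indicator {0..1} t \<partial>lborel)"
  proof (rule nn_integral_cmult)
    \<comment> \<open>\<open>Q\<close> is merely convex here, so measurability is taken from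
      continuity in the parameter t rather than from the gradient as a function on space.\<close>
    have "(\<lambda>t. indicator {0..1} t *\<^sub>R norm (?G (?\<gamma> t))) \<in> borel_measurable borel"
      by (intro borel_measurable_continuous_on_indicator continuous_intros cont) auto
    then have "(\<lambda>t. ennreal (indicator {0..1} t *\<^sub>R norm (?G (?\<gamma> t)))) \<in> borel_measurable lborel" by simp
    also have "(\<lambda>t. ennreal (indicator {0..1} t *\<^sub>R norm (?G (?\<gamma> t)))) =
        (\<lambda>t. ennreal (indicator Q (?\<gamma> t) * norm (?G (?\<gamma> t))) * indicator {0..1} t)"
      using \<gamma> by (auto simp: indicator_def fun_eq_iff)
    finally show "\<dots> \<in> borel_measurable lborel" .
  qed
  finally show ?thesis .
qed

lemma borel_measurable_gradient:
  fixes u :: "real ^ 'n::finite \<Rightarrow> real"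
  assumes "C1_on Q u" "Q \<in> sets borel"
  shows "(\<lambda>x. indicator Q x * norm (gradient_on Q u x)) \<in> borel_measurable borel"
  using borel_measurable_continuous_on_indicator[of Q "\<lambda>x. norm (gradient_on Q u x)"] assms
  by (auto simp: C1_on_def intro!: continuous_intros)

lemma cube_norm_diff_le:
  fixes x y :: "real ^ 'n::finite"
  assumes "cube l Q" "x \<in> Q" "y \<in> Q"
  shows "norm (x - y) \<le> real CARD('n) * l"
  using sum_bounded_above[of UNIV "\<lambda>i. \<bar>(x - y) $ i\<bar>" l] norm_le_l1_cart[of "x - y"]
    cube_diff_le[OF assms] by simp

text \<open>Rays from x and from y to the averaging point have length at most n s in a subcube of
  side s \<le> 2 |x - y|, and the volume s^n cancels. The bound holds at every pair of points of
  \<open>Q\<close>, as is necessary for measures that charge null sets.\<close>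

lemma C1_on_diff_le_maximal:
  fixes u :: "real ^ 'n::finite \<Rightarrow> real"
  assumes u: "C1_on Q u" and Q: "cube l Q" and xy: "x \<in> Q" "y \<in> Q"
  defines "g \<equiv> maximal_fun (\<lambda>z. ennreal (indicator Q z * norm (gradient_on Q u z)))"
  shows "ennreal \<bar>u x - u y\<bar> \<le> ennreal (2 * CARD('n) * norm (x - y)) * (g x + g y)"
proof (cases "x = y")
  case False
  let ?N = "real CARD('n)"
  let ?f = "\<lambda>z. ennreal (indicator Q z * norm (gradient_on Q u z))"
  let ?R = "\<lambda>x z. \<integral>\<^sup>+t. ?f (x + t *\<^sub>R (z - x)) * indicator {0..1::real} t \<partial>lborel"
  obtain s Q' where Q': "cube s Q'" "Q' \<subseteq> Q" "x \<in> Q'" "y \<in> Q'" "s \<le> 2 * norm (x - y)"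
    using subcube_ex[OF Q xy False] by blast
  have s: "s > 0" using Q' by (simp add: cube_def)
  have [measurable]: "Q \<in> sets borel" "Q' \<in> sets borel" using Q Q' cube_sets_borel by blast+
  have [measurable]: "(\<lambda>z. indicator Q z * norm (gradient_on Q u z)) \<in> borel_measurable borel"
    by (rule borel_measurable_gradient[OF u]) measurable
  have cvx: "convex Q" using cubeE[OF Q] by metis
  have ray: "ennreal \<bar>u v - u z\<bar> \<le> ennreal (?N * s) * ?R v z" if "v \<in> Q'" "z \<in> Q'" for v z
  proof -
    have "ennreal \<bar>u v - u z\<bar> \<le> ennreal (norm (z - v)) * ?R v z"
      using that Q' by (intro C1_on_diff_le[OF u cvx]) auto
    also have "\<dots> \<le> ennreal (?N * s) * ?R v z"
      using cube_norm_diff_le[OF Q'(1) that(2,1)] by (intro mult_right_mono ennreal_leI) auto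
    finally show ?thesis .
  qed
  have "ennreal \<bar>u x - u y\<bar> * ennreal (s ^ CARD('n)) = (\<integral>\<^sup>+z. ennreal \<bar>u x - u y\<bar> * indicator Q' z \<partial>lborel)"
    by (simp add: nn_integral_cmult_indicator emeasure_lborel_cube[OF Q'(1)])
  also have "\<dots> \<le> (\<integral>\<^sup>+z. ennreal (?N * s) * (indicator Q' z * ?R x z + indicator Q' z * ?R y z) \<partial>lborel)"
  proof (intro nn_integral_mono)
    fix z
    show "ennreal \<bar>u x - u y\<bar> * indicator Q' z \<le> ennreal (?N * s) * (indicator Q' z * ?R x z + indicator Q' z * ?R y z)"
    proof (cases "z \<in> Q'")
      case True
      have "ennreal \<bar>u x - u y\<bar> \<le> ennreal \<bar>u x - u z\<bar> + ennreal \<bar>u y - u z\<bar>"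
        by (simp flip: ennreal_plus)
      also have "\<dots> \<le> ennreal (?N * s) * ?R x z + ennreal (?N * s) * ?R y z"
        using ray Q' True by (intro add_mono) auto
      finally show ?thesis using True by (simp add: distrib_left)
    qed simp
  qed
  also have "\<dots> = ennreal (?N * s) * ((\<integral>\<^sup>+z. indicator Q' z * ?R x z \<partial>lborel) + (\<integral>\<^sup>+z. indicator Q' z * ?R y z \<partial>lborel))"
    by (subst nn_integral_cmult) (measurable, subst nn_integral_add, measurable)
  also have "\<dots> \<le> ennreal (?N * s) * (g x * ennreal (s ^ CARD('n)) + g y * ennreal (s ^ CARD('n)))"
    unfolding g_def by (intro mult_left_mono add_mono nn_integral_rays_le Q') simp_all
  also have "\<dots> \<le> ennreal (2 * ?N * norm (x - y)) * (g x * ennreal (s ^ CARD('n)) + g y * ennreal (s ^ CARD('n)))"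
    using Q'(5) by (intro mult_right_mono ennreal_leI) (auto simp: mult_ac intro!: mult_left_mono)
  also have "\<dots> = ennreal (2 * ?N * norm (x - y)) * (g x + g y) * ennreal (s ^ CARD('n))"
    by (simp add: algebra_simps)
  finally have "ennreal (s ^ CARD('n)) * ennreal \<bar>u x - u y\<bar> \<le>
      ennreal (s ^ CARD('n)) * (ennreal (2 * ?N * norm (x - y)) * (g x + g y))"
    by (simp add: mult_ac)
  then show ?thesis using s by (subst (asm) ennreal_mult_le_mult_iff) auto
qed simp

section \<open>The fractional energy\<close>

lemma epowr_ennreal: "x \<ge> 0 \<Longrightarrow> epowr (ennreal x) a = ennreal (x powr a)"
  by (simp add: epowr_def)

lemma epowr_mono:
  assumes "x \<le> y" "a \<ge> 0"
  shows "epowr x a \<le> epowr y a"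
proof (cases y)
  case (real s)
  then obtain r where "x = ennreal r" "0 \<le> r" "r \<le> s"
    using assms(1) by (cases x) (auto simp: top_unique)
  then show ?thesis
    using real assms(2) by (auto simp: epowr_ennreal intro!: ennreal_leI powr_mono2)
qed (simp add: epowr_def)

lemma epowr_cmult:
  assumes "c > 0"
  shows "epowr (ennreal c * x) a = ennreal (c powr a) * epowr x a"
proof (cases x)
  case (real r)
  then show ?thesis
    using assms by (simp add: epowr_ennreal powr_mult ennreal_mult flip: ennreal_mult)
next
  case top
  then show ?thesis using assms by (simp add: epowr_def ennreal_mult_top)
qed

lemma epowr_add_le:
  assumes "a \<ge> 0"
  shows "epowr (x + y) a \<le> ennreal (2 powr a) * (epowr x a + epowr y a)"
proof -
  have "epowr (x + y) a \<le> epowr (ennreal 2 * max x y) a"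
  proof (rule epowr_mono[OF _ assms])
    have "x + y \<le> max x y + max x y" by (intro add_mono) auto
    then show "x + y \<le> ennreal 2 * max x y" by (simp add: mult_2)
  qed
  also have "\<dots> = ennreal (2 powr a) * epowr (max x y) a" by (rule epowr_cmult) simp
  also have "\<dots> \<le> ennreal (2 powr a) * (epowr x a + epowr y a)"
    by (intro mult_left_mono) (auto simp: max_def intro: add_increasing add_increasing2)
  finally show ?thesis .
qed

lemma borel_measurable_epowr [measurable]:
  assumes [measurable]: "f \<in> borel_measurable M"
  shows "(\<lambda>x. epowr (f x) a) \<in> borel_measurable M"
  unfolding epowr_def by measurable

text \<open>With this the kernel estimate, stated for general measures, becomes a bound by a
  constant for Lebesgue measure.\<close>

lemma maximal_lborel_le_1: "maximal lborel (x :: real ^ 'n::finite) \<le> 1"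
  unfolding maximal_def
proof (rule SUP_least)
  fix Q :: "(real ^ 'n) set" assume "Q \<in> {Q. (\<exists>l. cube l Q) \<and> x \<in> Q}"
  then obtain l where l: "cube l Q" by auto
  then have "l > 0" by (simp add: cube_def)
  then show "emeasure lborel Q / emeasure lborel Q \<le> 1"
    unfolding emeasure_lborel_cube[OF l] by (simp add: divide_ennreal)
qed

lemma sets_restrict_to: "sets (restrict_to Q \<mu>) = sets \<mu>"
  by (simp add: restrict_to_def)

text \<open>Every point shares some large cube with \<open>Q\<close>, and that cube has infinite
  mass but finite volume.\<close>

lemma maximal_infinite_measure:
  fixes \<nu> :: "(real ^ 'n::finite) measure"
  assumes sets: "sets \<nu> = sets borel" and Q: "cube l Q" and inf: "emeasure \<nu> Q = \<infinity>"
  shows "maximal \<nu> x = \<infinity>"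
proof -
  obtain a where a: "Q \<subseteq> cbox a (a + (\<chi> i. l))" using cubeE[OF Q] by metis
  define r where "r = 1 + norm (a - x) + l"
  have l: "l > 0" using Q by (simp add: cube_def)
  have r: "r > 0" using l by (simp add: r_def add_pos_nonneg add_nonneg_pos)
  have "Q \<subseteq> ocube x r"
  proof
    fix y assume "y \<in> Q"
    then have "a $ i \<le> y $ i \<and> y $ i \<le> a $ i + l" for i using a by (auto simp: mem_box_cart subset_iff)
    moreover have "\<bar>a $ i - x $ i\<bar> \<le> norm (a - x)" for i
      using component_le_norm_cart[of "a - x" i] by simp
    ultimately have "\<bar>y $ i - x $ i\<bar> < r" for i
      unfolding r_def by (smt (verit) l)
    then show "y \<in> ocube x r" by (simp add: ocube_def)
  qed
  then have "emeasure \<nu> Q \<le> emeasure \<nu> (ocube x r)"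
    by (intro emeasure_mono) (simp_all add: sets open_ocube)
  also have "\<dots> \<le> maximal \<nu> x * ennreal ((2 * r) ^ CARD('n))"
    using r by (intro emeasure_le_maximal cube_ocube) (auto simp: ocube_def)
  finally have "maximal \<nu> x * ennreal ((2 * r) ^ CARD('n)) = \<infinity>"
    using inf by (simp add: top_unique)
  then show ?thesis by (simp add: ennreal_mult_eq_top_iff)
qed

text \<open>Here d stands for 1 - \<delta>, and p - (n + (1 - d) p) = p d - n is the exponent of the
  kernel estimate. The base 4 n is the 2 n of the pointwise bound times the 2 from splitting the
  p-th power of g(x) + g(y).\<close>

lemma fractional_quotient_le:
  fixes u :: "real ^ 'n::finite \<Rightarrow> real" and p d :: real
  assumes u: "C1_on Q u" and Q: "cube l Q" and xy: "x \<in> Q" "y \<in> Q" and p: "p > 1"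
  defines "g \<equiv> maximal_fun (\<lambda>z. ennreal (indicator Q z * norm (gradient_on Q u z)))"
  shows "ennreal (\<bar>u x - u y\<bar> powr p / norm (x - y) powr (CARD('n) + (1 - d) * p)) \<le>
    ennreal ((4 * CARD('n)) powr p) * (ennreal (norm (x - y) powr (p * d - CARD('n))) * (epowr (g x) p + epowr (g y) p))"
proof (cases "x = y")
  case False
  define r where "r = norm (x - y)"
  have r: "r > 0" using False by (simp add: r_def)
  let ?N = "real CARD('n)"
  let ?B = "r powr (?N + (1 - d) * p)"
  have "epowr (ennreal \<bar>u x - u y\<bar>) p \<le> epowr (ennreal (2 * ?N * r) * (g x + g y)) p"
    using C1_on_diff_le_maximal[OF u Q xy] p by (intro epowr_mono) (auto simp: g_def r_def)
  also have "\<dots> = ennreal ((2 * ?N * r) powr p) * epowr (g x + g y) p"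
    using r by (intro epowr_cmult) simp
  also have "\<dots> \<le> ennreal ((2 * ?N * r) powr p) * (ennreal (2 powr p) * (epowr (g x) p + epowr (g y) p))"
    using p by (intro mult_left_mono epowr_add_le) auto
  also have "\<dots> = ennreal ((2 * ?N * r) powr p * 2 powr p) * (epowr (g x) p + epowr (g y) p)"
    by (simp add: ennreal_mult mult.assoc)
  also have "(2 * ?N * r) powr p * 2 powr p = (4 * ?N) powr p * r powr p"
  proof -
    have "(2 * ?N * r) powr p * 2 powr p = (2 * (2 * ?N * r)) powr p"
      using r by (subst powr_mult) auto
    also have "\<dots> = ((4 * ?N) * r) powr p" by (simp add: mult_ac)
    also have "\<dots> = (4 * ?N) powr p * r powr p" using r by (intro powr_mult)
    finally show ?thesis .
  qed
  finally have "ennreal (1 / ?B) * ennreal (\<bar>u x - u y\<bar> powr p) \<le>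
      ennreal (1 / ?B) * (ennreal ((4 * ?N) powr p * r powr p) * (epowr (g x) p + epowr (g y) p))"
    by (intro mult_left_mono) (auto simp: epowr_ennreal)
  also have "\<dots> = ennreal (1 / ?B * ((4 * ?N) powr p * r powr p)) * (epowr (g x) p + epowr (g y) p)"
    by (subst ennreal_mult[of "1 / ?B"]) (simp_all add: mult.assoc)
  also have "1 / ?B * ((4 * ?N) powr p * r powr p) = (4 * ?N) powr p * r powr (p * d - ?N)"
  proof -
    have "r powr (p * d - ?N) = r powr (p - (?N + (1 - d) * p))" by (simp add: algebra_simps)
    also have "\<dots> = r powr p / ?B" by (rule powr_diff)
    finally show ?thesis by simp
  qed
  also have "ennreal ((4 * ?N) powr p * r powr (p * d - ?N)) = ennreal ((4 * ?N) powr p) * ennreal (r powr (p * d - ?N))"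
    by (rule ennreal_mult) auto
  also have "ennreal (1 / ?B) * ennreal (\<bar>u x - u y\<bar> powr p) = ennreal (\<bar>u x - u y\<bar> powr p / ?B)"
    by (simp flip: ennreal_mult)
  finally show ?thesis by (simp add: r_def mult.assoc)
qed simp

text \<open>Finite mass makes Tonelli's theorem available for \<nu> and Lebesgue measure. The two
  summands are integrated in opposite orders: for g(x) the y-integral of the kernel is at most a
  constant, for g(y) the x-integral leaves M\<nu>(y).\<close>

lemma fractional_energy_le_finite:
  fixes u :: "real ^ 'n::finite \<Rightarrow> real" and p d :: real and \<mu> :: "(real ^ 'n) measure"
  assumes u: "C1_on Q u" and Q: "cube l Q" and p: "p > 1" and d: "0 < d" "d < 1" and \<mu>: "sets \<mu> = sets borel"
    and fin: "emeasure \<mu> Q \<noteq> \<infinity>"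
  defines "f \<equiv> \<lambda>z. indicator Q z * norm (gradient_on Q u z)"
  defines "\<nu> \<equiv> restrict_to Q \<mu>"
  shows "(\<integral>\<^sup>+x\<in>Q. (\<integral>\<^sup>+y\<in>Q. ennreal (\<bar>u x - u y\<bar> powr p / norm (x - y) powr (CARD('n) + (1 - d) * p)) \<partial>lborel) \<partial>\<mu>) \<le>
    ennreal ((4 * CARD('n)) powr p) * (ennreal (CARD('n) powr p * 8 ^ CARD('n) * (4 / d) * l powr (p * d)) *
    (2 * (ennreal (3 ^ CARD('n) * (2 * 4 powr p * (p / (p - 1)))) *
    (\<integral>\<^sup>+x. ennreal (f x powr p) * maximal_fun (maximal \<nu>) x \<partial>lborel))))"
    (is "?L \<le> ?c * (?A * (2 * (?B * ?R)))")
proof -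
  define c where "c = ?c"
  define A where "A = ?A"
  define B where "B = ?B"
  define R where "R = ?R"
  define g where "g = maximal_fun (\<lambda>z. ennreal (f z))"
  define G where "G x = epowr (g x) p" for x
  define K where "K x y = ennreal (norm (x - y) powr (p * d - CARD('n)))" for x y :: "real ^ 'n"
  have mQ [measurable]: "Q \<in> sets borel" using Q cube_sets_borel by blast
  have \<nu>: "sets \<nu> = sets borel" by (simp add: \<nu>_def sets_restrict_to \<mu>)
  note [measurable_cong] = \<mu> \<nu>
  have [measurable]: "f \<in> borel_measurable borel" unfolding f_def by (rule borel_measurable_gradient[OF u mQ])
  have [measurable]: "g \<in> borel_measurable borel" "maximal \<nu> \<in> borel_measurable borel"
    by (auto simp: g_def maximal_fun_def intro!: borel_measurable_maximal \<nu>)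
  have [measurable]: "G \<in> borel_measurable borel" unfolding G_def by measurable
  have [measurable]: "(\<lambda>(x, y). K x y) \<in> borel_measurable (borel \<Otimes>\<^sub>M borel)" unfolding K_def by measurable
  have f0: "f x \<ge> 0" for x by (simp add: f_def)
  have finite: "finite_measure \<nu>"
    by (rule finite_measureI)
      (use fin in \<open>simp add: \<nu>_def restrict_to_def emeasure_density sets_eq_imp_space_eq[OF \<mu>]\<close>)
  interpret \<nu>: finite_measure \<nu> by (rule finite)
  interpret P: pair_sigma_finite \<nu> lborel ..
  have AEQ: "AE x in \<nu>. x \<in> Q"
    unfolding \<nu>_def restrict_to_def by (subst AE_density) (auto simp: indicator_def)
  have FS1: "(\<integral>\<^sup>+x. G x \<partial>\<nu>) \<le> B * R"
  proof -
    have "(\<integral>\<^sup>+x. G x \<partial>\<nu>) \<le> B * (\<integral>\<^sup>+x. ennreal (f x powr p) * maximal \<nu> x \<partial>lborel)"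
      unfolding G_def g_def B_def by (rule Fefferman_Stein[OF \<nu> _ f0 p]) measurable
    also have "\<dots> \<le> B * R"
      unfolding R_def by (intro mult_left_mono nn_integral_mono maximal_le_maximal_fun_maximal \<nu>) auto
    finally show ?thesis .
  qed
  \<comment> \<open>The measure with density M\<nu> has the maximal function M(M\<nu>) by
    definition, so unlike in \<open>FS1\<close> no comparison of weights is involved.\<close>
  have FS2: "(\<integral>\<^sup>+y. G y * maximal \<nu> y \<partial>lborel) \<le> B * R"
  proof -
    have "(\<integral>\<^sup>+y. G y * maximal \<nu> y \<partial>lborel) = (\<integral>\<^sup>+y. G y \<partial>density lborel (maximal \<nu>))"
      by (subst nn_integral_density) (auto simp: mult.commute)
    also have "\<dots> \<le> B * (\<integral>\<^sup>+x. ennreal (f x powr p) * maximal (density lborel (maximal \<nu>)) x \<partial>lborel)"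
      unfolding G_def g_def B_def by (rule Fefferman_Stein[OF _ _ f0 p]) auto
    finally show ?thesis by (simp add: maximal_fun_def R_def)
  qed
  have ker1: "(\<integral>\<^sup>+y. indicator Q y * K x y \<partial>lborel) \<le> A" if "x \<in> Q" for x
  proof -
    have "(\<integral>\<^sup>+y. indicator Q y * K x y \<partial>lborel) \<le> A * maximal lborel x"
      using nn_integral_kernel_le[OF sets_lborel Q that p d] by (simp add: K_def A_def norm_minus_commute)
    also have "\<dots> \<le> A * 1" by (intro mult_left_mono maximal_lborel_le_1) simp
    finally show ?thesis by simp
  qed
  have ker2: "(\<integral>\<^sup>+x. indicator Q x * K x y \<partial>\<nu>) \<le> A * maximal \<nu> y" if "y \<in> Q" for y
    using nn_integral_kernel_le[OF \<nu> Q that p d] by (simp add: K_def A_def)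
  have "(\<integral>\<^sup>+x. (\<integral>\<^sup>+y. indicator Q x * (indicator Q y * K x y * G y) \<partial>lborel) \<partial>\<nu>) =
      (\<integral>\<^sup>+y. (\<integral>\<^sup>+x. indicator Q x * (indicator Q y * K x y * G y) \<partial>\<nu>) \<partial>lborel)"
    by (rule P.Fubini'[symmetric]) measurable
  also have "\<dots> = (\<integral>\<^sup>+y. indicator Q y * G y * (\<integral>\<^sup>+x. indicator Q x * K x y \<partial>\<nu>) \<partial>lborel)"
    by (intro nn_integral_cong, subst nn_integral_cmult[symmetric]) (auto intro!: nn_integral_cong simp: mult_ac)
  also have "\<dots> \<le> (\<integral>\<^sup>+y. A * (G y * maximal \<nu> y) \<partial>lborel)"
  proof (intro nn_integral_mono)
    fix y
    show "indicator Q y * G y * (\<integral>\<^sup>+x. indicator Q x * K x y \<partial>\<nu>) \<le> A * (G y * maximal \<nu> y)"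
      using mult_left_mono[OF ker2, of y "G y"] by (auto simp: indicator_def mult_ac)
  qed
  also have "\<dots> = A * (\<integral>\<^sup>+y. G y * maximal \<nu> y \<partial>lborel)"
    by (rule nn_integral_cmult) simp
  finally have J: "(\<integral>\<^sup>+x. (\<integral>\<^sup>+y. indicator Q x * (indicator Q y * K x y * G y) \<partial>lborel) \<partial>\<nu>) \<le> \<dots>" .
  have "?L \<le> (\<integral>\<^sup>+x\<in>Q. (\<integral>\<^sup>+y\<in>Q. c * (K x y * (G x + G y)) \<partial>lborel) \<partial>\<mu>)"
  proof (intro nn_integral_mono)
    fix x
    show "(\<integral>\<^sup>+y\<in>Q. ennreal (\<bar>u x - u y\<bar> powr p / norm (x - y) powr (CARD('n) + (1 - d) * p)) \<partial>lborel) * indicator Q x \<le>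
        (\<integral>\<^sup>+y\<in>Q. c * (K x y * (G x + G y)) \<partial>lborel) * indicator Q x"
    proof (cases "x \<in> Q")
      case True
      have "(\<integral>\<^sup>+y\<in>Q. ennreal (\<bar>u x - u y\<bar> powr p / norm (x - y) powr (CARD('n) + (1 - d) * p)) \<partial>lborel) \<le>
          (\<integral>\<^sup>+y\<in>Q. c * (K x y * (G x + G y)) \<partial>lborel)"
        using fractional_quotient_le[OF u Q True _ p]
        by (intro nn_integral_mono) (auto simp: indicator_def K_def G_def g_def f_def c_def)
      then show ?thesis by (rule mult_right_mono) simp
    qed simp
  qed
  also have "\<dots> = (\<integral>\<^sup>+x. (\<integral>\<^sup>+y\<in>Q. c * (K x y * (G x + G y)) \<partial>lborel) \<partial>\<nu>)"
    unfolding \<nu>_def restrict_to_def by (subst nn_integral_density) (auto simp: mult.commute)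
  also have "\<dots> = (\<integral>\<^sup>+x. c * (G x * (\<integral>\<^sup>+y. indicator Q y * K x y \<partial>lborel) + (\<integral>\<^sup>+y. indicator Q y * K x y * G y \<partial>lborel)) \<partial>\<nu>)"
  proof (rule nn_integral_cong)
    fix x
    have "(\<integral>\<^sup>+y\<in>Q. c * (K x y * (G x + G y)) \<partial>lborel) =
        (\<integral>\<^sup>+y. c * (G x * (indicator Q y * K x y) + indicator Q y * K x y * G y) \<partial>lborel)"
      by (intro nn_integral_cong) (simp add: algebra_simps)
    also have "\<dots> = c * (G x * (\<integral>\<^sup>+y. indicator Q y * K x y \<partial>lborel) + (\<integral>\<^sup>+y. indicator Q y * K x y * G y \<partial>lborel))"
      by (simp add: nn_integral_cmult nn_integral_add)
    finally show "(\<integral>\<^sup>+y\<in>Q. c * (K x y * (G x + G y)) \<partial>lborel) = \<dots>" .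
  qed
  \<comment> \<open>\<nu>-almost every x lies in \<open>Q\<close>; \<open>ker1\<close> requires
    this, and it allows \<open>indicator Q x\<close> to be inserted as in \<open>J\<close>.\<close>
  also have "\<dots> \<le> (\<integral>\<^sup>+x. c * (G x * A + (\<integral>\<^sup>+y. indicator Q x * (indicator Q y * K x y * G y) \<partial>lborel)) \<partial>\<nu>)"
    using AEQ by (intro nn_integral_mono_AE)
      (auto elim!: eventually_mono intro!: mult_left_mono add_mono ker1)
  also have "\<dots> = c * ((\<integral>\<^sup>+x. G x \<partial>\<nu>) * A + (\<integral>\<^sup>+x. (\<integral>\<^sup>+y. indicator Q x * (indicator Q y * K x y * G y) \<partial>lborel) \<partial>\<nu>))"
    by (simp add: nn_integral_cmult nn_integral_add nn_integral_multc)
  also have "\<dots> \<le> c * ((\<integral>\<^sup>+x. G x \<partial>\<nu>) * A + A * (\<integral>\<^sup>+y. G y * maximal \<nu> y \<partial>lborel))"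
    by (intro mult_left_mono add_left_mono J) simp
  also have "\<dots> \<le> c * ((B * R) * A + A * (B * R))"
    by (intro mult_left_mono add_mono mult_right_mono FS1 FS2) auto
  also have "\<dots> = c * (A * (2 * (B * R)))"
    by (simp add: algebra_simps flip: mult_2_right)
  finally show ?thesis unfolding c_def A_def B_def R_def .
qed

text \<open>A gradient that vanishes almost everywhere has maximal function zero at every point, so
  the pointwise bound makes u constant on \<open>Q\<close>, whatever null sets \<mu>
  charges.\<close>

lemma fractional_energy_eq_0:
  fixes u :: "real ^ 'n::finite \<Rightarrow> real" and p s :: real
  assumes u: "C1_on Q u" and Q: "cube l Q" and p: "p > 0"
    and ae: "AE x in lborel. indicator Q x * norm (gradient_on Q u x) = 0"
  shows "(\<integral>\<^sup>+x\<in>Q. (\<integral>\<^sup>+y\<in>Q. ennreal (\<bar>u x - u y\<bar> powr p / norm (x - y) powr s) \<partial>lborel) \<partial>\<mu>) = 0"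
proof -
  let ?f = "\<lambda>z. ennreal (indicator Q z * norm (gradient_on Q u z))"
  have [measurable]: "(\<lambda>z. indicator Q z * norm (gradient_on Q u z)) \<in> borel_measurable borel"
    using Q cube_sets_borel by (intro borel_measurable_gradient[OF u]) blast
  have "maximal_fun ?f x \<le> 0" for x
    unfolding maximal_fun_def maximal_def
  proof (rule SUP_least)
    fix S :: "(real ^ 'n) set" assume "S \<in> {S. (\<exists>l. cube l S) \<and> x \<in> S}"
    then have [measurable]: "S \<in> sets borel" using cube_sets_borel by blast
    have "emeasure (density lborel ?f) S = (\<integral>\<^sup>+z. ?f z * indicator S z \<partial>lborel)"
      by (simp add: emeasure_density)
    also have "\<dots> = 0"
      using ae by (subst nn_integral_0_iff_AE) (auto elim!: eventually_mono)
    finally show "emeasure (density lborel ?f) S / emeasure lborel S \<le> 0" by simp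
  qed
  then have "ennreal \<bar>u x - u y\<bar> \<le> 0" if "x \<in> Q" "y \<in> Q" for x y
    using C1_on_diff_le_maximal[OF u Q that] by simp
  note le0 = this
  have eq: "u x = u y" if "x \<in> Q" "y \<in> Q" for x y
    using le0[OF that] by simp
  have "(\<integral>\<^sup>+y\<in>Q. ennreal (\<bar>u x - u y\<bar> powr p / norm (x - y) powr s) \<partial>lborel) * indicator Q x = 0" for x
  proof (cases "x \<in> Q")
    case True
    have "(\<integral>\<^sup>+y\<in>Q. ennreal (\<bar>u x - u y\<bar> powr p / norm (x - y) powr s) \<partial>lborel) = (\<integral>\<^sup>+(y::real^'n). 0 \<partial>lborel)"
    proof (rule nn_integral_cong)
      fix y
      show "ennreal (\<bar>u x - u y\<bar> powr p / norm (x - y) powr s) * indicator Q y = 0"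
        using eq[OF True, of y] by (cases "y \<in> Q") auto
    qed
    then show ?thesis by simp
  qed simp
  then show ?thesis by (simp only:) simp
qed

text \<open>All numerical factors are gathered into one p-th power. The part 16 * 24^n * p' occurs
  to the first power only; being at least 1, it is bounded by its p-th power. The constant 256 is 16
  * 16, one factor from 4 N * N * 4 and the other from the numerals 4 * 2 * 2.\<close>

lemma energy_constant_le:
  fixes p d l N :: real
  assumes "N \<ge> 1" "p > 1" "0 < d" "l > 0"
  shows "(4 * N) powr p * (N powr p * 8 ^ n * (4 / d) * l powr (p * d) * (2 * (3 ^ n * (2 * 4 powr p * (p / (p - 1)))))) \<le>
    (256 * N\<^sup>2 * 24 ^ n * (p / (p - 1))) powr p / d * l powr (p * d)"
proof -
  define q where "q = p / (p - 1)"
  have q: "q \<ge> 1" using assms by (simp add: q_def)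
  have "(4 * N) powr p * N powr p * 4 powr p = (4 * N * N * 4) powr p"
    using assms by (simp flip: powr_mult)
  also have "\<dots> = (16 * N\<^sup>2) powr p" by (simp add: power2_eq_square mult_ac)
  finally have 1: "(4 * N) powr p * N powr p * 4 powr p = (16 * N\<^sup>2) powr p" .
  have 2: "(8::real) ^ n * 3 ^ n = 24 ^ n" by (subst power_mult_distrib[symmetric]) simp
  have "1 \<le> 16 * (24::real) ^ n" using one_le_power[of "24::real" n] by linarith
  then have big: "1 \<le> 16 * 24 ^ n * q" using q mult_mono[of 1 "16 * 24 ^ n" 1 q] by simp
  have powr1: "(16 * 24 ^ n * q) powr 1 = 16 * 24 ^ n * q" using big by (intro powr_one) linarith
  have "(4 * N) powr p * (N powr p * 8 ^ n * (4 / d) * l powr (p * d) * (2 * (3 ^ n * (2 * 4 powr p * q)))) =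
      ((4 * N) powr p * N powr p * 4 powr p) * (16 * (8 ^ n * 3 ^ n) * q) * (l powr (p * d) / d)"
    by simp
  also have "\<dots> = (16 * N\<^sup>2) powr p * (16 * 24 ^ n * q) powr 1 * (l powr (p * d) / d)"
    unfolding 1 2 powr1 by simp
  also have "\<dots> \<le> (16 * N\<^sup>2) powr p * (16 * 24 ^ n * q) powr p * (l powr (p * d) / d)"
    using assms big by (intro mult_right_mono mult_left_mono powr_mono) auto
  also have "(16 * N\<^sup>2) powr p * (16 * 24 ^ n * q) powr p = ((16 * N\<^sup>2) * (16 * 24 ^ n * q)) powr p"
    using big assms by (simp only: powr_mult)
  also have "(16 * N\<^sup>2) * (16 * 24 ^ n * q) = 256 * N\<^sup>2 * 24 ^ n * q" by simp
  finally show ?thesis unfolding q_def by simp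
qed

text \<open>Removes the finiteness of \<mu>(Q). If the mass is infinite, so is the weight at every
  point, and a finite right side forces the gradient to vanish almost everywhere on
  \<open>Q\<close>.\<close>

lemma fractional_energy_le:
  fixes u :: "real ^ 'n::finite \<Rightarrow> real" and p d l :: real and \<mu> :: "(real ^ 'n) measure"
  assumes u: "C1_on Q u" and Q: "cube l Q" and p: "p > 1" and d: "0 < d" "d < 1" and \<mu>: "sets \<mu> = sets borel"
  shows "(\<integral>\<^sup>+x\<in>Q. (\<integral>\<^sup>+y\<in>Q. ennreal (\<bar>u x - u y\<bar> powr p / norm (x - y) powr (CARD('n) + (1 - d) * p)) \<partial>lborel) \<partial>\<mu>) \<le>
    ennreal ((256 * (real CARD('n))\<^sup>2 * 24 ^ CARD('n) * (p / (p - 1))) powr p / d * l powr (p * d)) *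
    (\<integral>\<^sup>+x\<in>Q. ennreal (norm (gradient_on Q u x) powr p) * maximal_fun (maximal (restrict_to Q \<mu>)) x \<partial>lborel)"
    (is "?L \<le> ennreal ?C * ?R")
proof -
  define f where "f z = indicator Q z * norm (gradient_on Q u z)" for z
  define M where "M = maximal_fun (maximal (restrict_to Q \<mu>))"
  have mQ [measurable]: "Q \<in> sets borel" using Q cube_sets_borel by blast
  have \<nu>: "sets (restrict_to Q \<mu>) = sets borel" by (simp add: sets_restrict_to \<mu>)
  have [measurable]: "f \<in> borel_measurable borel"
    unfolding f_def by (rule borel_measurable_gradient[OF u mQ])
  have [measurable]: "M \<in> borel_measurable borel"
    by (auto simp: M_def maximal_fun_def intro!: borel_measurable_maximal)
  have l: "l > 0" using Q by (simp add: cube_def)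
  have N: "real CARD('n) \<ge> 1" by (simp add: Suc_leI)
  have R: "?R = (\<integral>\<^sup>+x. ennreal (f x powr p) * M x \<partial>lborel)"
    by (intro nn_integral_cong) (auto simp: f_def M_def indicator_def)
  show ?thesis
  proof (cases "emeasure \<mu> Q = \<infinity>")
    case False
    have "?L \<le> ennreal ((4 * CARD('n)) powr p) * (ennreal (CARD('n) powr p * 8 ^ CARD('n) * (4 / d) * l powr (p * d)) *
        (2 * (ennreal (3 ^ CARD('n) * (2 * 4 powr p * (p / (p - 1)))) * ?R)))"
      unfolding R f_def M_def by (rule fractional_energy_le_finite[OF u Q p d \<mu> False])
    also have "\<dots> = ennreal ((4 * CARD('n)) powr p * (CARD('n) powr p * 8 ^ CARD('n) * (4 / d) * l powr (p * d) *
        (2 * (3 ^ CARD('n) * (2 * 4 powr p * (p / (p - 1))))))) * ?R"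
    proof -
      have mult4: "ennreal a * (ennreal b * (2 * (ennreal c * r))) = ennreal (a * (b * (2 * c))) * r"
        if "a \<ge> 0" "b \<ge> 0" "c \<ge> 0" for a b c r
        using that by (simp add: ennreal_mult mult.assoc)
      show ?thesis using p d by (intro mult4) auto
    qed
    also have "\<dots> \<le> ennreal ?C * ?R"
      using energy_constant_le[OF N p d(1) l, of "CARD('n)"]
      by (intro mult_right_mono ennreal_leI) auto
    finally show ?thesis .
  next
    case True
    have "emeasure (restrict_to Q \<mu>) Q = emeasure \<mu> Q"
      unfolding restrict_to_def by (subst emeasure_density) (auto simp: \<mu> nn_integral_indicator cong: measurable_cong_sets simp flip: indicator_inter_arith)
    then have top: "maximal (restrict_to Q \<mu>) x = \<infinity>" for x
      using True by (intro maximal_infinite_measure[OF \<nu> Q]) simp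
    have M: "M x = \<infinity>" for x
      using maximal_le_maximal_fun_maximal[OF \<nu>, of x] by (simp add: M_def top top_unique)
    show ?thesis
    proof (cases "?R = \<infinity>")
      case True
      \<comment> \<open>Positivity is essential because \<open>0 * \<infinity> = 0\<close> in
        \<open>ennreal\<close>.\<close>
      have "?C > 0" using p d l N by (intro mult_pos_pos divide_pos_pos) (auto intro!: mult_pos_pos)
      moreover have "ennreal c * \<infinity> = \<infinity>" if "c > 0" for c
        using that by (simp add: ennreal_mult_eq_top_iff)
      ultimately have "ennreal ?C * \<infinity> = \<infinity>" by blast
      then show ?thesis unfolding True by simp
    next
      case False
      then have "AE x in lborel. ennreal (f x powr p) * M x \<noteq> \<infinity>"
        unfolding R by (intro nn_integral_PInf_AE) auto
      then have "AE x in lborel. f x = 0"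
        by (auto elim!: eventually_mono simp: M ennreal_mult_top split: if_splits)
      then have "?L = 0"
        unfolding f_def using p by (intro fractional_energy_eq_0[OF u Q]) auto
      then show ?thesis by simp
    qed
  qed
qed

theorem mainTheorem4:
  assumes "CARD('n::finite) \<ge> 2"
  shows "\<exists>C::real. C > 0 \<and>
    (\<forall>(\<delta>::real) (p::real) (\<mu> :: (real ^ 'n) measure) (l::real) (Q :: (real ^ 'n) set)
        (u :: real ^ 'n \<Rightarrow> real).
      0 < \<delta> \<longrightarrow> \<delta> < 1 \<longrightarrow> 1 < p \<longrightarrow> sets \<mu> = sets borel \<longrightarrow> cube l Q \<longrightarrow> C1_on Q u \<longrightarrow>
      ennreal (l powr \<delta>) *
        epowr (\<integral>\<^sup>+x\<in>Q. (\<integral>\<^sup>+y\<in>Q.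
                  ennreal (\<bar>u x - u y\<bar> powr p / norm (x - y) powr (real CARD('n) + \<delta> * p))
                \<partial>lborel) \<partial>\<mu>) (1 / p)
      \<le> ennreal (C * (p / (p - 1)) / (1 - \<delta>) powr (1 / p)) * ennreal l *
        epowr (\<integral>\<^sup>+x\<in>Q. ennreal (norm (gradient_on Q u x) powr p) *
                  maximal_fun (maximal (restrict_to Q \<mu>)) x \<partial>lborel) (1 / p))"
proof (intro exI[of _ "256 * (real CARD('n))\<^sup>2 * 24 ^ CARD('n)"] conjI allI impI)
  let ?C = "256 * (real CARD('n))\<^sup>2 * 24 ^ CARD('n)"
  show "?C > 0" by simp
  fix \<delta> p l :: real and \<mu> :: "(real ^ 'n) measure" and Q :: "(real ^ 'n) set" and u :: "real ^ 'n \<Rightarrow> real"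
  assume \<delta>: "0 < \<delta>" "\<delta> < 1" and p: "1 < p" and \<mu>: "sets \<mu> = sets borel" and Q: "cube l Q" and u: "C1_on Q u"
  let ?L = "\<integral>\<^sup>+x\<in>Q. (\<integral>\<^sup>+y\<in>Q.
                  ennreal (\<bar>u x - u y\<bar> powr p / norm (x - y) powr (real CARD('n) + \<delta> * p))
                \<partial>lborel) \<partial>\<mu>"
  let ?R = "\<integral>\<^sup>+x\<in>Q. ennreal (norm (gradient_on Q u x) powr p) *
                  maximal_fun (maximal (restrict_to Q \<mu>)) x \<partial>lborel"
  define q where "q = ?C * (p / (p - 1))"
  define d where "d = 1 - \<delta>"
  have d: "0 < d" "d < 1" using \<delta> by (auto simp: d_def)
  have l: "l > 0" using Q by (simp add: cube_def)
  have q: "q > 0" using p unfolding q_def by (intro mult_pos_pos) auto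
  have "?L \<le> ennreal (q powr p / d * l powr (p * d)) * ?R"
    using fractional_energy_le[OF u Q p d \<mu>] by (simp add: q_def d_def)
  then have "epowr ?L (1 / p) \<le> epowr (ennreal (q powr p / d * l powr (p * d)) * ?R) (1 / p)"
    using p by (intro epowr_mono) auto
  also have "\<dots> = ennreal ((q powr p / d * l powr (p * d)) powr (1 / p)) * epowr ?R (1 / p)"
    using q d l by (intro epowr_cmult) simp
  \<comment> \<open>Only here does the p-th root act: \<open>q\<close>, the dimensional constant
    times p', comes out to the first power, and \<open>l powr d\<close> will combine with
    \<open>l powr \<delta>\<close> to the single factor \<open>l\<close>.\<close>
  also have "(q powr p / d * l powr (p * d)) powr (1 / p) = q / d powr (1 / p) * l powr d"
    using q d l p by (simp add: powr_mult powr_divide powr_powr)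
  finally have "ennreal (l powr \<delta>) * epowr ?L (1 / p) \<le>
      ennreal (l powr \<delta>) * (ennreal (q / d powr (1 / p) * l powr d) * epowr ?R (1 / p))"
    by (rule mult_left_mono) simp
  also have "\<dots> = ennreal (l powr \<delta> * (q / d powr (1 / p) * l powr d)) * epowr ?R (1 / p)"
    using q by (subst ennreal_mult[of "l powr \<delta>"]) (simp_all add: mult.assoc)
  also have "l powr \<delta> * (q / d powr (1 / p) * l powr d) = q / d powr (1 / p) * (l powr (\<delta> + d))"
    by (simp add: powr_add)
  also have "l powr (\<delta> + d) = l" using l by (simp add: d_def)
  also have "ennreal (q / d powr (1 / p) * l) = ennreal (q / d powr (1 / p)) * ennreal l"
    using q l by (intro ennreal_mult) auto
  finally show "ennreal (l powr \<delta>) * epowr ?L (1 / p) \<le>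
      ennreal (?C * (p / (p - 1)) / (1 - \<delta>) powr (1 / p)) * ennreal l * epowr ?R (1 / p)"
    by (simp add: q_def d_def)
qed

end
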